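(* For any positive constants $A$, $\delta$ there exists $T_0=T_0(A,\delta)$ such that $$\left|\frac1T\,\Phi_{\mathcal L}(x,y,T;h)-\beta\left(\frac hT\right)\right|<\delta$$ for all $T\ge T_0$, all $x,y\in\mathbf V_0$, and all $h\in\mathbb Z^{b(\Gamma_0)}$ with $\left|\frac hT\right|<A$.
   Context: **Graph.** A graph $(\mathbf V,\mathbf E)$ consists of disjoint sets of vertices and edges, a map $\mathrm o:\mathbf E\to\mathbf V$ (initial vertex) and a fixed-point-free involution $e\mapsto-e$ of $\mathbf E$ (reversed edge); $\mathrm t(e):=\mathrm o(-e)$. A path is a finite sequence of edges $e_1,\dots,e_m$ with $\mathrm o(e_i)=\mathrm t(e_{i-1})$; it links $\mathrm o(e_1)$ to $\mathrm t(e_m)$, and is a cycle if these coincide. $\Gamma_0=(\mathbf V_0,\mathbf E_0)$ is a finite connected graph and $b=b(\Gamma_0)=\frac12|\mathbf E_0|-|\mathbf V_0|+1$. Fix an orientation $\mathbf E_0^+$ (one edge from each pair $\{e,-e\}$) and a spanning tree with edge set $\mathbf E_{\mathbf T}$ (closed under reversal). Then $\mathbf E_0^+\setminus\mathbf E_{\mathbf T}=\{f_1,\dots,f_b\}$, and $\theta:\mathbf E_0\to\mathbb Z^b$ is defined by $\theta(\pm f_i)=\pm$ the $i$-th standard basis vector, $\theta(e)=0$ for $e\in\mathbf E_{\mathbf T}$ (with $H_1(\Gamma_0,\mathbb R)$ identified with $\mathbb R^b$ through the basis of fundamental circuits). The rotation vector of a path $(e_i)_{i=1}^m$ is $\sum_i\theta(e_i)\in\mathbb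 Z^b$. **Hamiltonians.** $\{H_e\}_{e\in\mathbf E_0}$, $H_e:[0,1]\times\mathbb R\to\mathbb R$, is a family with $H_{-e}(s,\rho)=H_e(1-s,-\rho)$, each $H_e(s,\rho)$ continuous in $s$, continuously differentiable and strictly convex in $\rho$, with $\lim_{\rho\to+\infty}H_e(s,\rho)/\rho=+\infty$ uniformly in $s$. **Discrete Hamiltonian and Lagrangian.** $a_e:=\max_{s\in[0,1]}\min_\rho H_e(s,\rho)$. For $a\ge a_e$, $\sigma_a^+(e,s):=\max\{\rho: H_e(s,\rho)=a\}$ and $\sigma(e,a):=\int_0^1\sigma_a^+(e,s)\,ds$; $a\mapsto\sigma(e,a)$ is continuous and strictly increasing; put $b_e:=\sigma(e,a_e)$ and let $\mathcal H(e,\cdot):[b_e,+\infty)\to[a_e,+\infty)$ be its inverse. $\mathcal L(e,\lambda):=\max_{\rho\ge b_e}(\rho\lambda-\mathcal H(e,\rho))$ for $\lambda\ge0$; in particular $\mathcal L(e,0)=\mathcal L(-e,0)=-a_e$. **Parametrized paths.** A parametrized path in $\Gamma_0$ is $\xi=(e_i,q_i,T_i)_{i=1}^m$ where $(e_i)$ is a path, $q_i\ge0$, $T_i=1/q_i$ if $q_i>0$ and $T_i$ is a positive constant if $q_i=0$, and where $\xi$ is a concatenation of nonsingular pieces (all $q_i>0$) and equilibrium circuits (consecutive edges $e,-e$, both with speed $0$ and with arbitrary positive times). Its total time is $T_\xi=\sum_iT_i$, its action is $A_{\mathcal L}(\xi):=\sum_iT_i\,\mathcal L(e_i,q_i)$.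 For $x,y\in\mathbf V_0$, $T>0$, $h\in\mathbb Z^b$, $\Phi_{\mathcal L}(x,y,T;h)$ is the infimum of $A_{\mathcal L}(\xi)$ over the parametrized paths $\xi$ linking $x$ to $y$ with total time $T$ and rotation vector $h$. **Measures and $\beta$.** $T^+\Gamma_0:=\mathbf E_0\times[0,+\infty)/\sim$ with $(e,0)\sim(-e,0)$, with the distance $d((e_1,q_1),(e_2,q_2))=q_1+q_2+1$ if $e_1\ne\pm e_2$, $q_1+q_2$ if $e_1=-e_2$, $|q_1-q_2|$ if $e_1=e_2$. $\mathbb P$ is the set of Borel probability measures on $T^+\Gamma_0$ with finite first moment (in $q$), with the first Wasserstein distance. The occupation measure of a parametrized path $\xi$ is $\mu_\xi=\frac1{T_\xi}\sum_iT_i\,\delta(e_i,q_i)$, $\delta(e,q)$ being the Dirac mass at $(e,q)$. $\mathbb M$ (closed measures) is the closure in $\mathbb P$ of the set of occupation measures of parametrized cycles. For $\mu\in\mathbb M$ its rotation vector is $\rho(\mu)=\int q\,\theta(e)\,d\mu(e,q)\in\mathbb R^b$, and its action is $A(\mu)=\int\mathcal L\,d\mu\in(-\infty,+\infty]$. Mather's $\beta$-function is $\beta:\mathbb R^b\to\mathbb R$, $\beta(h):=\inf\{A(\mu):\mu\in\mathbb M,\ \rho(\mu)=h\}$. *)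

theory Defs
  imports
    "HOL-Probability.Probability"
    "Graph_Theory.Digraph_Component"
    "Graph_Theory.Bidirected_Digraph"
begin

text \<open>
  A graph is a \<^locale>\<open>bidirected_digraph\<close>: \<^term>\<open>tail G e\<close> is the initial vertex of \<open>e\<close> and
  \<^term>\<open>arev e\<close> is the reversed edge. Loops and parallel edges are allowed.

  With \<^term>\<open>ET\<close> closed under reversal, the only vertex-simple closed walks in a tree are the
  back-and-forth walks \<open>e, -e\<close>. The notion \<^const>\<open>tree\<close> of the library is not used, as it counts
  those walks as cycles.

  Vectors of \<open>\<real>\<^sup>b\<close> and \<open>\<int>\<^sup>b\<close> are functions on \<^typ>\<open>nat\<close> vanishing from index \<open>b\<close> on, as in
  \<^const>\<open>Euclidean_space\<close>; this includes \<open>b = 0\<close>, the case of a tree.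

  There must be an edge: a single vertex without edges has no parametrized path and no probability
  measure on its (empty) tangent cone, so that \<open>\<beta>\<close> would not be real-valued.
\<close>

locale rotation_graph = fin_digraph G + bidirected_digraph G arev
  for G :: "('v, 'e) pre_digraph" (structure) and arev :: "'e \<Rightarrow> 'e" +
  fixes Eplus ET :: "'e set" and f :: "nat \<Rightarrow> 'e"
  assumes connected_graph: "Digraph_Component.connected G"
    and arcs_nonempty: "arcs G \<noteq> {}"
    and orientation_subset: "Eplus \<subseteq> arcs G"
    and orientation: "e \<in> arcs G \<Longrightarrow> e \<in> Eplus \<longleftrightarrow> arev e \<notin> Eplus"
    and tree_subset: "ET \<subseteq> arcs G"
    and tree_reversal: "e \<in> ET \<Longrightarrow> arev e \<in> ET"
    and tree_connected: "Digraph_Component.connected (G\<lparr>arcs := ET\<rparr>)"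
    and tree_no_circuit:
      "pre_digraph.cycle (G\<lparr>arcs := ET\<rparr>) p \<Longrightarrow> \<exists>e. p = [e, arev e]"
    and enumeration:
      "bij_betw f {..<card (arcs G) div 2 + 1 - card (verts G)} (Eplus - ET)"
begin

definition betti :: nat where
  "betti = card (arcs G) div 2 + 1 - card (verts G)"

definition theta :: "'e \<Rightarrow> nat \<Rightarrow> int" where
  "theta e i = (if i < betti \<and> e = f i then 1
                else if i < betti \<and> e = arev (f i) then - 1 else 0)"

definition path_rotation :: "'e list \<Rightarrow> nat \<Rightarrow> int" where
  "path_rotation es i = (\<Sum>e\<leftarrow>es. theta e i)"

text \<open>
  A parametrized path is a list of triples \<open>(e, q, t)\<close> of an edge, a speed and a time. The
  following predicate says that it is a concatenation of nonsingular pieces and equilibrium circuits.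
\<close>

inductive admissible :: "('e \<times> real \<times> real) list \<Rightarrow> bool" where
  nil: "admissible []"
| moving: "0 < q \<Longrightarrow> admissible \<xi> \<Longrightarrow> admissible ((e, q, 1 / q) # \<xi>)"
| equilibrium: "0 < t \<Longrightarrow> 0 < t' \<Longrightarrow> admissible \<xi> \<Longrightarrow>
    admissible ((e, 0, t) # (arev e, 0, t') # \<xi>)"

definition param_path :: "'v \<Rightarrow> ('e \<times> real \<times> real) list \<Rightarrow> 'v \<Rightarrow> bool" where
  "param_path x \<xi> y \<longleftrightarrow> \<xi> \<noteq> [] \<and> awalk x (map fst \<xi>) y \<and> admissible \<xi>"

definition total_time :: "('e \<times> real \<times> real) list \<Rightarrow> real" where
  "total_time \<xi> = (\<Sum>(e, q, t)\<leftarrow>\<xi>. t)"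

text \<open>
  Points of the tangent cone \<open>T\<^sup>+\<Gamma>\<^sub>0\<close> are equivalence classes of pairs \<open>(e, q)\<close>. A function on pairs
  that respects the equivalence takes one value on a class, which is extracted by
  \<^const>\<open>the_elem\<close>.
\<close>

definition cone_rel :: "(('e \<times> real) \<times> ('e \<times> real)) set" where
  "cone_rel = {((e, q), (e', q')). e \<in> arcs G \<and> e' \<in> arcs G \<and> 0 \<le> q \<and> q' = q \<and>
     (e' = e \<or> q = 0 \<and> e' = arev e)}"

definition tangent_cone :: "('e \<times> real) set set" where
  "tangent_cone = (arcs G \<times> {0..}) // cone_rel"

definition point :: "'e \<Rightarrow> real \<Rightarrow> ('e \<times> real) set" where
  "point e q = cone_rel `` {(e, q)}"

definition lift :: "('e \<Rightarrow> real \<Rightarrow> real) \<Rightarrow> ('e \<times> real) set \<Rightarrow> real" where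
  "lift g X = the_elem ((\<lambda>(e, q). g e q) ` X)"

definition pair_dist :: "'e \<times> real \<Rightarrow> 'e \<times> real \<Rightarrow> real" where
  "pair_dist = (\<lambda>(e, q) (e', q').
     if e = e' then \<bar>q - q'\<bar> else if e = arev e' then q + q' else q + q' + 1)"

text \<open>
  The value 0 off the cone only serves the locale \<^locale>\<open>Metric_space\<close>, which requires symmetry and
  nonnegativity also outside of the carrier.
\<close>

definition cone_dist :: "('e \<times> real) set \<Rightarrow> ('e \<times> real) set \<Rightarrow> real" where
  "cone_dist X Y = (if X \<in> tangent_cone \<and> Y \<in> tangent_cone
     then the_elem ((\<lambda>(x, y). pair_dist x y) ` (X \<times> Y)) else 0)"

lemma cone_point: "X \<in> tangent_cone \<Longrightarrow> \<exists>e q. e \<in> arcs G \<and> 0 \<le> q \<and> X = point e q"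
  by (auto simp: tangent_cone_def point_def quotient_def)

lemma point_in_cone: "e \<in> arcs G \<Longrightarrow> 0 \<le> q \<Longrightarrow> point e q \<in> tangent_cone"
  by (auto simp: tangent_cone_def point_def quotient_def)

lemma arev_eq_iff: "arev e = arev e' \<longleftrightarrow> e = e'"
  by (metis arev_arev)

lemma point_eq: "e \<in> arcs G \<Longrightarrow> 0 \<le> q \<Longrightarrow>
    point e q = (if q = 0 then {(e, 0), (arev e, 0)} else {(e, q)})"
  by (auto simp: point_def cone_rel_def)

lemma cone_dist_point:
  assumes "e \<in> arcs G" "0 \<le> q" "e' \<in> arcs G" "0 \<le> q'"
  shows "cone_dist (point e q) (point e' q') = pair_dist (e, q) (e', q')"
proof -
  have *: "pair_dist x y = pair_dist (e, q) (e', q')" if "x \<in> point e q" "y \<in> point e' q'" for x y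
    using that assms by (auto simp: point_eq pair_dist_def arev_neq arev_eq_iff split: if_splits)
  have "(\<lambda>(x, y). pair_dist x y) ` (point e q \<times> point e' q') = {pair_dist (e, q) (e', q')}"
  proof
    show "(\<lambda>(x, y). pair_dist x y) ` (point e q \<times> point e' q') \<subseteq> {pair_dist (e, q) (e', q')}"
      using * by auto
    have "(e,q) \<in> point e q" "(e',q') \<in> point e' q'" using assms by (auto simp: point_eq)
    then show "{pair_dist (e, q) (e', q')} \<subseteq> (\<lambda>(x, y). pair_dist x y) ` (point e q \<times> point e' q')"
      by force
  qed
  then show ?thesis using assms by (simp add: cone_dist_def point_in_cone)
qed

lemma Metric_space_cone: "Metric_space tangent_cone cone_dist"
proof
  fix X Y Z
  have P: "\<exists>e q. e \<in> arcs G \<and> 0 \<le> q \<and> X = point e q" if "X \<in> tangent_cone" for X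
    using cone_point[OF that] .
  have pd: "pair_dist (e,q) (e',q') \<ge> 0" if "q \<ge> 0" "q' \<ge> 0" for e q e' q'
    using that by (auto simp: pair_dist_def)
  have pc: "pair_dist (e,q) (e',q') = pair_dist (e',q') (e,q)" for e q e' q'
    by (auto simp: pair_dist_def)
  show "0 \<le> cone_dist X Y"
  proof (cases "X \<in> tangent_cone \<and> Y \<in> tangent_cone")
    case True
    then obtain e q e' q' where "e \<in> arcs G" "0 \<le> q" "X = point e q"
      "e' \<in> arcs G" "0 \<le> q'" "Y = point e' q'"
      using P[of X] P[of Y] by auto
    then show ?thesis using pd by (simp add: cone_dist_point)
  next
    case False
    then show ?thesis unfolding cone_dist_def by (simp only: if_False order_refl)
  qed
  show "cone_dist X Y = cone_dist Y X"
  proof (cases "X \<in> tangent_cone \<and> Y \<in> tangent_cone")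
    case True
    then obtain e q e' q' where "e \<in> arcs G" "0 \<le> q" "X = point e q"
      "e' \<in> arcs G" "0 \<le> q'" "Y = point e' q'"
      using P[of X] P[of Y] by auto
    then show ?thesis using pc by (simp add: cone_dist_point)
  next
    case False
    then show ?thesis by (auto simp: cone_dist_def)
  qed
  show "cone_dist X Y = 0 \<longleftrightarrow> X = Y" if XYZ: "X \<in> tangent_cone" "Y \<in> tangent_cone"
  proof -
    obtain e q e' q' where
      a: "e \<in> arcs G" "0 \<le> q" "X = point e q" "e' \<in> arcs G" "0 \<le> q'" "Y = point e' q'"
      using P[OF XYZ(1)] P[OF XYZ(2)] by auto
    have "pair_dist (e,q) (e',q') = 0 \<longleftrightarrow> point e q = point e' q'"
      using a arev_neq[of e] arev_neq[of e'] by (auto simp: pair_dist_def point_eq doubleton_eq_iff)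
    then show ?thesis using a by (simp add: cone_dist_point)
  qed
  show "cone_dist X Z \<le> cone_dist X Y + cone_dist Y Z"
    if XYZ: "X \<in> tangent_cone" "Y \<in> tangent_cone" "Z \<in> tangent_cone"
  proof -
    obtain e q e' q' e'' q'' where
      a: "e \<in> arcs G" "0 \<le> q" "X = point e q" "e' \<in> arcs G" "0 \<le> q'" "Y = point e' q'"
        "e'' \<in> arcs G" "0 \<le> q''" "Z = point e'' q''"
      using P[OF XYZ(1)] P[OF XYZ(2)] P[OF XYZ(3)] by auto
    have "pair_dist (e,q) (e'',q'') \<le> pair_dist (e,q) (e',q') + pair_dist (e',q') (e'',q'')"
      using a(2,5,8) by (simp add: pair_dist_def abs_if arev_eq_iff)
    then show ?thesis using a by (simp add: cone_dist_point)
  qed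
qed
definition cone_borel :: "('e \<times> real) set measure" where
  "cone_borel =
     sigma tangent_cone (Collect (openin (Metric_space.mtopology tangent_cone cone_dist)))"

definition prob_measures :: "('e \<times> real) set measure set" where
  "prob_measures = {\<mu>. sets \<mu> = sets cone_borel \<and> prob_space \<mu> \<and>
     integrable \<mu> (lift (\<lambda>e q. q))}"

definition couplings ::
  "('e \<times> real) set measure \<Rightarrow> ('e \<times> real) set measure
    \<Rightarrow> (('e \<times> real) set \<times> ('e \<times> real) set) measure set" where
  "couplings \<mu> \<nu> = {\<pi>. sets \<pi> = sets (cone_borel \<Otimes>\<^sub>M cone_borel) \<and>
     distr \<pi> cone_borel fst = \<mu> \<and> distr \<pi> cone_borel snd = \<nu>}"

definition wasserstein :: "('e \<times> real) set measure \<Rightarrow> ('e \<times> real) set measure \<Rightarrow> ennreal" where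
  "wasserstein \<mu> \<nu> = (INF \<pi>\<in>couplings \<mu> \<nu>. \<integral>\<^sup>+ (X, Y). ennreal (cone_dist X Y) \<partial>\<pi>)"

definition occupation :: "('e \<times> real \<times> real) list \<Rightarrow> ('e \<times> real) set measure" where
  "occupation \<xi> = measure_of tangent_cone (sets cone_borel)
     (\<lambda>S. ennreal (1 / total_time \<xi> * (\<Sum>(e, q, t)\<leftarrow>\<xi>. t * indicator S (point e q))))"

definition closed_measures :: "('e \<times> real) set measure set" where
  "closed_measures = {\<mu> \<in> prob_measures. \<forall>\<epsilon>>0. \<exists>x \<xi>. param_path x \<xi> x \<and>
     wasserstein \<mu> (occupation \<xi>) < ennreal \<epsilon>}"

definition measure_rotation :: "('e \<times> real) set measure \<Rightarrow> nat \<Rightarrow> real" where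
  "measure_rotation \<mu> i = (\<integral>X. lift (\<lambda>e q. q * of_int (theta e i)) X \<partial>\<mu>)"

end

locale hamiltonian_graph = rotation_graph G arev Eplus ET f
  for G :: "('v, 'e) pre_digraph" (structure) and arev :: "'e \<Rightarrow> 'e"
    and Eplus ET :: "'e set" and f :: "nat \<Rightarrow> 'e" +
  fixes H :: "'e \<Rightarrow> real \<Rightarrow> real \<Rightarrow> real"
  assumes H_reversal:
      "e \<in> arcs G \<Longrightarrow> s \<in> {0..1} \<Longrightarrow> H (arev e) s \<rho> = H e (1 - s) (- \<rho>)"
    and H_continuous: "e \<in> arcs G \<Longrightarrow> continuous_on {0..1} (\<lambda>s. H e s \<rho>)"
    and H_C1: "e \<in> arcs G \<Longrightarrow> s \<in> {0..1} \<Longrightarrow> H e s C1_differentiable_on UNIV"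
    and H_strictly_convex:
      "e \<in> arcs G \<Longrightarrow> s \<in> {0..1} \<Longrightarrow> \<rho> \<noteq> \<rho>' \<Longrightarrow> 0 < r \<Longrightarrow> r < 1 \<Longrightarrow>
        H e s ((1 - r) * \<rho> + r * \<rho>') < (1 - r) * H e s \<rho> + r * H e s \<rho>'"
    and H_superlinear:
      "e \<in> arcs G \<Longrightarrow> \<forall>\<^sub>F \<rho> in at_top. \<forall>s\<in>{0..1}. K \<le> H e s \<rho> / \<rho>"
begin

text \<open>
  All suprema and infima of \<^term>\<open>H\<close> below are attained under the assumptions on \<^term>\<open>H\<close>, so that
  they are maxima and minima.
\<close>

definition min_level :: "'e \<Rightarrow> real" where
  "min_level e = (SUP s\<in>{0..1}. INF \<rho>. H e s \<rho>)"

definition sigma_plus :: "real \<Rightarrow> 'e \<Rightarrow> real \<Rightarrow> real" where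
  "sigma_plus a e s = Sup {\<rho>. H e s \<rho> = a}"

definition sigma_int :: "'e \<Rightarrow> real \<Rightarrow> real" where
  "sigma_int e a = integral {0..1} (\<lambda>s. sigma_plus a e s)"

definition min_momentum :: "'e \<Rightarrow> real" where
  "min_momentum e = sigma_int e (min_level e)"

definition discrete_ham :: "'e \<Rightarrow> real \<Rightarrow> real" where
  "discrete_ham e = the_inv_into {min_level e..} (sigma_int e)"

definition discrete_lag :: "'e \<Rightarrow> real \<Rightarrow> real" where
  "discrete_lag e v = (SUP \<rho>\<in>{min_momentum e..}. \<rho> * v - discrete_ham e \<rho>)"

definition path_action :: "('e \<times> real \<times> real) list \<Rightarrow> real" where
  "path_action \<xi> = (\<Sum>(e, q, t)\<leftarrow>\<xi>. t * discrete_lag e q)"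

definition min_action :: "'v \<Rightarrow> 'v \<Rightarrow> real \<Rightarrow> (nat \<Rightarrow> int) \<Rightarrow> ereal" where
  "min_action x y T h = (INF \<xi>\<in>{\<xi>. param_path x \<xi> y \<and> total_time \<xi> = T \<and>
     path_rotation (map fst \<xi>) = h}. ereal (path_action \<xi>))"

text \<open>
  The Lagrangian is bounded below, so the subtracted integral of the negative part is finite.
\<close>

definition measure_action :: "('e \<times> real) set measure \<Rightarrow> ereal" where
  "measure_action \<mu> = enn2ereal (\<integral>\<^sup>+ X. ennreal (lift discrete_lag X) \<partial>\<mu>)
     - enn2ereal (\<integral>\<^sup>+ X. ennreal (- lift discrete_lag X) \<partial>\<mu>)"

definition mather_beta :: "(nat \<Rightarrow> real) \<Rightarrow> ereal" where
  "mather_beta h = (INF \<mu>\<in>{\<mu> \<in> closed_measures. measure_rotation \<mu> = h}. measure_action \<mu>)"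

end

end

theory Submission
  imports Defs
begin

text \<open>
  Both bounds have an error that is bounded independently of \<open>T\<close>: the minimal action differs from
  \<open>T \<beta>(h / T)\<close> by at most a constant depending on \<open>A\<close>.

  A path with rotation vector \<open>h\<close> and time \<open>T\<close> can be closed up, repeated about \<open>T / 2\<close> times and
  completed to a cycle whose mean rotation vector is exactly \<open>h / T\<close>; its occupation measure bounds
  \<open>\<beta>\<close> from above.

  Conversely, Jensen's inequality replaces a closed measure by its masses and fluxes on the edges. The
  flux is nearly a nonnegative combination of finitely many short loops. Rounding \<open>T - 1\<close> times the
  coefficients down gives an integral flow below the flux, so the loops can be run at the mean speeds
  without exceeding the time available on any edge. The time left over is spent at rest, and the
  bounded defect of the rotation vector is corrected within the last unit of time.
\<close>

section \<open>Walks and rotation vectors\<close>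

context rotation_graph
begin

text \<open>The mean speed \<open>flux \<mu> e / mass \<mu> e\<close> can be arbitrarily large, so
  the loops have to run at exactly that speed; this is why the integral flow must stay below the
  flux and not merely near it. The price of the rest time is controlled by a single line: the
  Lagrangian lies above the line of slope \<open>min_momentum e\<close> through its value at speed
  0. Replacing motion at speed \<open>q\<close> during a time \<open>r\<close> by rest therefore
  costs at most the absolute value of \<open>min_momentum e * r * q\<close>, and here
  \<open>r * q\<close> is the flux lost by rounding, which is bounded. The support of the flow need
  not be connected, so its loops are spliced into a carrier path that runs through every edge at
  positive speed. The carrier also makes the corrections: its length is linear in the rotation
  vector that it realizes, so its speed, and with it its action per unit of time, stays bounded.
  Both comparisons realize the rotation vector exactly, so \<beta> is evaluated only at the point
  \<open>h / T\<close>.\<close>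

lemma tree_awalk:
  assumes "u \<in> verts G" "v \<in> verts G"
  shows "\<exists>p. awalk u p v \<and> set p \<subseteq> ET"
proof -
  let ?S = "mk_symmetric (G\<lparr>arcs := ET\<rparr>)"
  have "u \<rightarrow>\<^sup>*\<^bsub>with_proj ?S\<^esub> v"
    using tree_connected assms
    unfolding Digraph_Component.connected_def strongly_connected_def by auto
  then have "(u, v) \<in> rtrancl_on (verts G) (parcs ?S)"
    by (simp add: reachable_def)
  then show ?thesis
  proof (induction rule: rtrancl_on.induct)
    case (rtrancl_on_refl a)
    then show ?case by (intro exI[of _ "[]"]) (simp add: awalk_Nil_iff)
  next
    case (rtrancl_on_into_rtrancl_on a b c)
    then obtain p where p: "awalk a p b" "set p \<subseteq> ET" by blast
    \<comment> \<open>Connectedness concerns the symmetrized graph, so a step may run against a tree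
      edge; the reversed edge is then taken instead.\<close>
    obtain e where e: "e \<in> ET" "tail G e = b" "head G e = c"
    proof -
      obtain e' where "e' \<in> ET" "(b, c) = (tail G e', head G e') \<or> (b, c) = (head G e', tail G e')"
        using rtrancl_on_into_rtrancl_on(2) by (auto simp: parcs_mk_symmetric)
      then show ?thesis
        using that[of e'] that[of "arev e'"] tree_subset tree_reversal by auto
    qed
    then have "awalk b [e] c" using tree_subset arc_implies_awalk by blast
    with p e show ?case
      by (intro exI[of _ "p @ [e]"]) (auto intro!: awalk_appendI simp del: awalk_append_iff)
  qed
qed

lemma path_rotation_Nil [simp]: "path_rotation [] i = 0"
  and path_rotation_Cons: "path_rotation (e # p) i = theta e i + path_rotation p i"
  and path_rotation_append: "path_rotation (p @ p') i = path_rotation p i + path_rotation p' i"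
  by (auto simp: path_rotation_def)

lemma f_Eplus: "i < betti \<Longrightarrow> f i \<in> Eplus - ET"
  using enumeration by (auto simp: betti_def bij_betw_def)

lemma f_inj: "i < betti \<Longrightarrow> j < betti \<Longrightarrow> f i = f j \<longleftrightarrow> i = j"
  using enumeration by (auto simp: betti_def bij_betw_def inj_on_def)

lemma f_arcs: "i < betti \<Longrightarrow> f i \<in> arcs G"
  using f_Eplus orientation_subset by blast

lemma theta_ge: "i \<ge> betti \<Longrightarrow> theta e i = 0"
  by (simp add: theta_def)

lemma theta_tree: "e \<in> ET \<Longrightarrow> theta e i = 0"
  using f_Eplus[of i] tree_reversal[of e] by (auto simp: theta_def)

lemma theta_arev: "theta (arev e) i = - theta e i"
proof (cases "i < betti")
  case True
  have "arev e = f i \<longleftrightarrow> e = arev (f i)" by (metis arev_arev)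
  moreover have "e = f i \<longleftrightarrow> arev e = arev (f i)" by (metis arev_arev)
  ultimately show ?thesis using True f_arcs[of i] arev_neq[of "f i"] by (auto simp: theta_def)
qed (simp add: theta_ge)

lemma theta_f:
  assumes i: "i < betti"
  shows "theta (f i) j = (if j = i then 1 else 0)"
proof (cases "j < betti")
  case True
  have "f i \<noteq> arev (f j)"
    using f_Eplus[OF i] f_Eplus[OF True] orientation[OF f_arcs[OF True]] by auto
  then show ?thesis using True f_inj[OF i True] by (auto simp: theta_def)
qed (use i in \<open>auto simp: theta_ge\<close>)

lemma theta_bound: "\<bar>theta e i\<bar> \<le> 1"
  by (simp add: theta_def)

lemma path_rotation_tree: "set p \<subseteq> ET \<Longrightarrow> path_rotation p i = 0"
  by (induction p) (auto simp: path_rotation_Cons theta_tree)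

lemma tree_awalk_without_rotation:
  assumes "u \<in> verts G" "v \<in> verts G"
  shows "\<exists>p. awalk u p v \<and> path_rotation p = (\<lambda>i. 0)"
  using tree_awalk[OF assms] path_rotation_tree by (auto simp: fun_eq_iff)

lemma awalk_split:
  assumes "awalk u (p @ q) v"
  shows "\<exists>w. awalk u p w \<and> awalk w q v"
  using assms by auto

lemma verts_nonempty: "verts G \<noteq> {}"
  using arcs_nonempty tail_in_verts by blast

section \<open>Walks with prescribed rotation and linearly bounded length\<close>

lemma back_and_forth:
  assumes "x \<in> verts G" "e \<in> arcs G"
  shows "\<exists>p. awalk x p x \<and> path_rotation p = (\<lambda>i. 0) \<and> e \<in> set p"
proof -
  obtain p q where p: "awalk x p (tail G e)" "path_rotation p = (\<lambda>i. 0)"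
    and q: "awalk (tail G e) q x" "path_rotation q = (\<lambda>i. 0)"
    using tree_awalk_without_rotation assms by (meson tail_in_verts)
  have "awalk (tail G e) [e, arev e] (tail G e)"
    using assms by (simp add: awalk_simps)
  then have "awalk x (p @ [e, arev e] @ q) x"
    using p q by (blast intro: awalk_appendI)
  moreover have "path_rotation (p @ [e, arev e] @ q) = (\<lambda>i. 0)"
    using p q by (auto simp: fun_eq_iff path_rotation_append path_rotation_Cons theta_arev)
  ultimately show ?thesis by (intro exI[of _ "p @ [e, arev e] @ q"]) simp
qed

text \<open>Each edge is traversed and at once retraced, and tree walks contribute no rotation.
  Adding such a loop makes any walk meet all edges without changing its rotation vector.\<close>

lemma exhausting_loop:
  assumes "x \<in> verts G"
  shows "\<exists>p. awalk x p x \<and> path_rotation p = (\<lambda>i. 0) \<and> arcs G \<subseteq> set p"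
proof -
  have "\<exists>p. awalk x p x \<and> path_rotation p = (\<lambda>i. 0) \<and> S \<subseteq> set p" if "S \<subseteq> arcs G" for S
  proof -
    have "finite S" using that finite_arcs finite_subset by blast
    then show ?thesis using that
    proof (induction S)
      case empty
      show ?case using assms by (intro exI[of _ "[]"]) (auto simp: awalk_simps)
    next
      case (insert e S)
      then obtain p where p: "awalk x p x" "path_rotation p = (\<lambda>i. 0)" "S \<subseteq> set p" by auto
      obtain q where q: "awalk x q x" "path_rotation q = (\<lambda>i. 0)" "e \<in> set q"
        using back_and_forth[OF assms, of e] insert by auto
      show ?case
        using p q awalk_appendI[OF p(1) q(1)]
        by (intro exI[of _ "p @ q"]) (auto simp: path_rotation_append simp del: awalk_append_iff)
    qed
  qed
  then show ?thesis by blast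
qed

lemma fundamental_loop:
  assumes "x \<in> verts G" "i < betti" "s \<in> {1, -1}"
  shows "\<exists>p. awalk x p x \<and> path_rotation p = (\<lambda>j. if j = i then s else 0)"
proof -
  define e where "e = (if s = 1 then f i else arev (f i))"
  have e: "e \<in> arcs G" using assms f_arcs by (auto simp: e_def)
  have th: "theta e j = (if j = i then s else 0)" for j
    using assms by (auto simp: e_def theta_f theta_arev)
  obtain p q where p: "awalk x p (tail G e)" "path_rotation p = (\<lambda>i. 0)"
    and q: "awalk (head G e) q x" "path_rotation q = (\<lambda>i. 0)"
    using tree_awalk_without_rotation assms(1) e by (meson tail_in_verts head_in_verts)
  have "awalk x (p @ [e] @ q) x"
    using p q arc_implies_awalk[OF e] by (blast intro: awalk_appendI)
  moreover have "path_rotation (p @ [e] @ q) = (\<lambda>j. if j = i then s else 0)"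
    using p q th by (auto simp: fun_eq_iff path_rotation_append path_rotation_Cons)
  ultimately show ?thesis by blast
qed

text \<open>One fundamental loop per unit of rotation suffices. The linear bound on the length later
  keeps speeds bounded when the rotation is of the order of the available time.\<close>

lemma loop_with_rotation:
  assumes x: "x \<in> verts G"
  shows "\<exists>M. \<forall>g. (\<forall>i\<ge>betti. g i = 0) \<longrightarrow>
    (\<exists>p. awalk x p x \<and> path_rotation p = g \<and> length p \<le> M * (\<Sum>i<betti. nat \<bar>g i\<bar>))"
proof -
  obtain P where P: "\<And>i s. i < betti \<Longrightarrow> s \<in> {1, -1} \<Longrightarrow>
      awalk x (P i s) x \<and> path_rotation (P i s) = (\<lambda>j. if j = i then s else 0)"
    using fundamental_loop[OF x] by metis
  define M where "M = (\<Sum>i<betti. length (P i 1) + length (P i (-1)))"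
  have M: "length (P i s) \<le> M" if "i < betti" "s \<in> {1, -1}" for i s
  proof -
    have "length (P i s) \<le> length (P i 1) + length (P i (-1))" using that by auto
    also have "\<dots> \<le> M" unfolding M_def using that by (intro member_le_sum) auto
    finally show ?thesis .
  qed
  have "\<exists>p. awalk x p x \<and> path_rotation p = g \<and> length p \<le> M * n"
    if "\<forall>i\<ge>betti. g i = 0" "n = (\<Sum>i<betti. nat \<bar>g i\<bar>)" for g n
    using that
  proof (induction n arbitrary: g)
    case 0
    then have "g i = 0" for i by (cases "i < betti") auto
    then show ?case using x by (intro exI[of _ "[]"]) (auto simp: awalk_simps fun_eq_iff)
  next
    case (Suc n)
    then obtain i where i: "i < betti" "g i \<noteq> 0"
      by (metis (no_types, lifting) abs_zero lessThan_iff nat_0_iff nat.distinct(1)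
          order_refl sum.neutral zero_less_Suc)
    \<comment> \<open>Removing one fundamental loop in the direction of the sign of
      \<open>g i\<close> lowers the induction measure by exactly one.\<close>
    define s where "s = sgn (g i)"
    define g' where "g' = g(i := g i - s)"
    have s: "s \<in> {1, -1}" using i by (auto simp: s_def sgn_if)
    have ai: "nat \<bar>g i\<bar> = Suc (nat \<bar>g' i\<bar>)" using i by (auto simp: g'_def s_def sgn_if)
    have "(\<Sum>k<betti. nat \<bar>g k\<bar>) = nat \<bar>g i\<bar> + (\<Sum>k\<in>{..<betti}-{i}. nat \<bar>g k\<bar>)"
      using i by (intro sum.remove) auto
    also have "(\<Sum>k\<in>{..<betti}-{i}. nat \<bar>g k\<bar>) = (\<Sum>k\<in>{..<betti}-{i}. nat \<bar>g' k\<bar>)"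
      by (intro sum.cong) (auto simp: g'_def)
    also have "nat \<bar>g i\<bar> + \<dots> = Suc (nat \<bar>g' i\<bar> + (\<Sum>k\<in>{..<betti}-{i}. nat \<bar>g' k\<bar>))"
      by (simp add: ai)
    also have "nat \<bar>g' i\<bar> + (\<Sum>k\<in>{..<betti}-{i}. nat \<bar>g' k\<bar>) = (\<Sum>k<betti. nat \<bar>g' k\<bar>)"
      using i by (intro sum.remove[symmetric]) auto
    finally have "n = (\<Sum>k<betti. nat \<bar>g' k\<bar>)" using Suc.prems by simp
    moreover have "\<forall>k\<ge>betti. g' k = 0" using Suc.prems i by (auto simp: g'_def)
    ultimately obtain p where p: "awalk x p x" "path_rotation p = g'" "length p \<le> M * n"
      using Suc.IH by blast
    have "awalk x (p @ P i s) x" using p P[OF i(1) s] awalk_appendI by blast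
    moreover have "path_rotation (p @ P i s) = g"
      using p P[OF i(1) s] by (auto simp: fun_eq_iff path_rotation_append g'_def)
    moreover have "length (p @ P i s) \<le> M * Suc n" using p M[OF i(1) s] by simp
    ultimately show ?case by blast
  qed
  then show ?thesis by blast
qed

text \<open>All walks are routed through one root \<open>r\<close>; as there are finitely many end
  points, the constant becomes independent of them.\<close>

lemma exhausting_walk_with_rotation:
  "\<exists>M. \<forall>x\<in>verts G. \<forall>y\<in>verts G. \<forall>g. (\<forall>i\<ge>betti. g i = 0) \<longrightarrow>
    (\<exists>p. awalk x p y \<and> path_rotation p = g \<and> arcs G \<subseteq> set p \<and>
       length p \<le> M * (1 + (\<Sum>i<betti. nat \<bar>g i\<bar>)))"
proof -
  obtain r where r: "r \<in> verts G" using verts_nonempty by blast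
  obtain M where M: "\<And>g. (\<forall>i\<ge>betti. g i = 0) \<Longrightarrow>
    (\<exists>p. awalk r p r \<and> path_rotation p = g \<and> length p \<le> M * (\<Sum>i<betti. nat \<bar>g i\<bar>))"
    using loop_with_rotation[OF r] by blast
  obtain W where W: "awalk r W r" "path_rotation W = (\<lambda>i. 0)" "arcs G \<subseteq> set W"
    using exhausting_loop[OF r] by blast
  obtain P where P: "\<And>u v. u \<in> verts G \<Longrightarrow> v \<in> verts G \<Longrightarrow>
      awalk u (P u v) v \<and> path_rotation (P u v) = (\<lambda>i. 0)"
    using tree_awalk_without_rotation by metis
  \<comment> \<open>The connections from \<open>x\<close> to \<open>r\<close> and from
    \<open>r\<close> to \<open>y\<close> belong to different summands of \<open>M'\<close>, which
    explains the factor 2 below.\<close>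
  define M' where "M' = M + length W + (\<Sum>u\<in>verts G. length (P u r) + length (P r u))"
  have "\<exists>p. awalk x p y \<and> path_rotation p = g \<and> arcs G \<subseteq> set p \<and>
       length p \<le> (2 * M') * (1 + (\<Sum>i<betti. nat \<bar>g i\<bar>))"
    if xy: "x \<in> verts G" "y \<in> verts G" and g: "\<forall>i\<ge>betti. g i = 0" for x y g
  proof -
    obtain p where p: "awalk r p r" "path_rotation p = g" "length p \<le> M * (\<Sum>i<betti. nat \<bar>g i\<bar>)"
      using M[OF g] by blast
    define q where "q = P x r @ W @ p @ P r y"
    have "awalk x q y" unfolding q_def using P r xy W p by (blast intro: awalk_appendI)
    moreover have "path_rotation q = g"
      unfolding q_def using P r xy W p by (auto simp: fun_eq_iff path_rotation_append)
    moreover have "arcs G \<subseteq> set q" using W by (auto simp: q_def)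
    moreover have "length q \<le> (2 * M') * (1 + (\<Sum>i<betti. nat \<bar>g i\<bar>))"
    proof -
      have "length (P u r) + length (P r u) \<le> (\<Sum>u\<in>verts G. length (P u r) + length (P r u))"
        if "u \<in> verts G" for u
        using that by (intro member_le_sum) auto
      from this[of x] this[of y] xy
      have "length q \<le> 2 * M' + length p" by (simp add: q_def M'_def)
      moreover have "length p \<le> 2 * M' * (\<Sum>i<betti. nat \<bar>g i\<bar>)"
        by (rule order_trans[OF p(3)], rule mult_right_mono) (simp_all add: M'_def)
      ultimately show ?thesis by (simp add: algebra_simps)
    qed
    ultimately show ?thesis by blast
  qed
  then show ?thesis by blast
qed

section \<open>Edge multiplicities of closed walks\<close>

definition short_loops :: "'e list set" where
  "short_loops = {p. length p \<le> card (verts G) \<and> (\<exists>u. awalk u p u)}"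

lemma finite_short_loops: "finite short_loops"
proof (rule finite_subset)
  show "short_loops \<subseteq> {p. set p \<subseteq> arcs G \<and> length p \<le> card (verts G)}"
    by (auto simp: short_loops_def)
  show "finite {p. set p \<subseteq> arcs G \<and> length p \<le> card (verts G)}"
    by (intro finite_lists_length_le finite_arcs)
qed

text \<open>Pigeonhole: a prefix with \<open>card (verts G)\<close> edges meets some vertex twice,
  so it contains a nonempty loop of at most that length. Cut it out and induct on the length.
  Admitting all loops of bounded length, simple or not, keeps the set finite and makes the removed
  loop a member at once. Only multiplicities are recorded because fluxes are determined by
  them.\<close>

lemma loop_decomposition:
  assumes "awalk u p u"
  shows "\<exists>k::'e list \<Rightarrow> nat. \<forall>e. count_list p e = (\<Sum>c\<in>short_loops. k c * count_list c e)"
  using assms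
proof (induction "length p" arbitrary: u p rule: less_induct)
  case less
  have unit: "(\<Sum>c\<in>short_loops. (if c = r then 1 else 0) * count_list c e) = count_list r e"
    if "r \<in> short_loops" for r e
  proof -
    have "(\<Sum>c\<in>short_loops. (if c = r then 1 else 0) * count_list c e) =
        (\<Sum>c\<in>short_loops. if c = r then count_list c e else 0)"
      by (intro sum.cong) auto
    then show ?thesis using that finite_short_loops by simp
  qed
  show ?case
  proof (cases "length p \<le> card (verts G)")
    case True
    then have "p \<in> short_loops" using less.prems by (auto simp: short_loops_def)
    then show ?thesis using unit[of p] by (intro exI[of _ "\<lambda>c. if c = p then 1 else 0"]) simp
  next
    case False
    define a b where "a = take (card (verts G)) p" and "b = drop (card (verts G)) p"
    have ab: "p = a @ b" "length a = card (verts G)"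
      using False by (auto simp: a_def b_def)
    obtain w where w: "awalk u a w" "awalk w b u" using less.prems ab awalk_split by blast
    have "\<not> distinct (awalk_verts u a)"
    proof
      assume "distinct (awalk_verts u a)"
      then have "card (set (awalk_verts u a)) = Suc (card (verts G))"
        using ab by (simp add: distinct_card length_awalk_verts)
      moreover have "set (awalk_verts u a) \<subseteq> verts G" using w(1) by blast
      ultimately show False using card_mono[OF finite_verts, of "set (awalk_verts u a)"] by simp
    qed
    then obtain q r s v where qrs: "a = q @ r @ s" "0 < length r"
      "awalk u q v" "awalk v r v" "awalk v s w"
      using awalk_not_distinct_decomp[OF w(1)] by blast
    have "r \<in> short_loops" using qrs ab by (auto simp: short_loops_def)
    have "awalk u (q @ s @ b) u" using qrs w by (blast intro: awalk_appendI)
    then obtain k where k: "\<And>e. count_list (q @ s @ b) e = (\<Sum>c\<in>short_loops. k c * count_list c e)"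
      using less.hyps[of "q @ s @ b"] qrs ab by auto
    show ?thesis
    proof (intro exI[of _ "\<lambda>c. k c + (if c = r then 1 else 0)"] allI)
      fix e
      have "count_list p e = count_list (q @ s @ b) e + count_list r e"
        by (simp add: ab(1) qrs(1) count_list_append)
      then show "count_list p e = (\<Sum>c\<in>short_loops. (k c + (if c = r then 1 else 0)) * count_list c e)"
        by (simp only: k add_mult_distrib sum.distrib unit[OF \<open>r \<in> short_loops\<close>])
    qed
  qed
qed

lemma sum_list_count:
  fixes g :: "'e \<Rightarrow> 'c::comm_semiring_1"
  assumes "set p \<subseteq> A" "finite A"
  shows "sum_list (map g p) = (\<Sum>e\<in>A. of_nat (count_list p e) * g e)"
  using assms(1)
proof (induction p)
  case (Cons a p)
  have "(\<Sum>e\<in>A. of_nat (count_list (a # p) e) * g e) =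
     (\<Sum>e\<in>A. (if e = a then g e else 0) + of_nat (count_list p e) * g e)"
    by (intro sum.cong) (auto simp: algebra_simps)
  also have "\<dots> = g a + (\<Sum>e\<in>A. of_nat (count_list p e) * g e)"
    using Cons assms by (simp add: sum.distrib)
  finally show ?case using Cons by simp
qed simp

section \<open>Splicing loops into parametrized paths\<close>

lemma admissible_append: "admissible \<xi> \<Longrightarrow> admissible \<zeta> \<Longrightarrow> admissible (\<xi> @ \<zeta>)"
  by (induction rule: admissible.induct) (auto intro: admissible.intros)

text \<open>
  Equilibrium circuits must not be torn apart, so a loop can only be inserted where both sides are
  admissible.
\<close>

definition exhausting :: "'v \<Rightarrow> ('e \<times> real \<times> real) list \<Rightarrow> 'v \<Rightarrow> bool" where
  "exhausting x \<xi> y \<longleftrightarrow> \<xi> \<noteq> [] \<and> (\<forall>v\<in>verts G. \<exists>\<xi>1 \<xi>2. \<xi> = \<xi>1 @ \<xi>2 \<and> admissible \<xi>1 \<and> admissible \<xi>2 \<and>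
     awalk x (map fst \<xi>1) v \<and> awalk v (map fst \<xi>2) y)"

lemma exhaustingE:
  assumes "exhausting x \<xi> y" "v \<in> verts G"
  obtains \<xi>1 \<xi>2 where "\<xi> = \<xi>1 @ \<xi>2" "admissible \<xi>1" "admissible \<xi>2"
    "awalk x (map fst \<xi>1) v" "awalk v (map fst \<xi>2) y"
  using assms unfolding exhausting_def by meson

lemma exhausting_param_path:
  assumes "exhausting x \<xi> y"
  shows "param_path x \<xi> y"
proof -
  obtain v where "v \<in> verts G" using verts_nonempty by blast
  then obtain \<xi>1 \<xi>2 where "\<xi> = \<xi>1 @ \<xi>2" "admissible \<xi>1" "admissible \<xi>2"
     "awalk x (map fst \<xi>1) v" "awalk v (map fst \<xi>2) y" by (rule exhaustingE[OF assms])
  then show ?thesis using assms awalk_appendI[of x "map fst \<xi>1" v "map fst \<xi>2" y]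
    by (auto simp: param_path_def exhausting_def admissible_append)
qed

lemma awalk_suffix:
  assumes "awalk x p u" "awalk x (p @ q) y"
  shows "awalk u q y"
proof -
  obtain w where w: "awalk x p w" "awalk w q y" using awalk_split[OF assms(2)] by blast
  then have "w = u" using awalk_ends[OF w(1) assms(1)] by auto
  then show ?thesis using w by simp
qed

text \<open>The speed of the first entry decides which rule built the list, so the derivations for
  the prefix and for the whole list peel off the same entries.\<close>

lemma admissible_suffix: "admissible \<xi> \<Longrightarrow> admissible (\<xi> @ \<zeta>) \<Longrightarrow> admissible \<zeta>"
proof (induction rule: admissible.induct)
  case (moving q \<xi> e)
  from moving(4) have "admissible (\<xi> @ \<zeta>)" by cases (use moving(1) in auto)
  then show ?case by (rule moving)
next
  case (equilibrium t t' \<xi> e)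
  from equilibrium(5) have "admissible (\<xi> @ \<zeta>)" by cases auto
  then show ?case by (rule equilibrium)
qed simp

text \<open>The split for a vertex \<open>v\<close> lies before or after the place of insertion. The
  piece between the two is admissible by cancellation, so the new path can again be split at
  \<open>v\<close> and further loops can be inserted. Time, rotation and action are all sums over
  the entries, hence the conclusion for every \<open>\<phi>\<close>.\<close>

lemma exhausting_insert:
  assumes ex: "exhausting x \<xi> y" and z: "awalk u (map fst \<zeta>) u" "admissible \<zeta>"
  shows "\<exists>\<xi>'. exhausting x \<xi>' y \<and>
    (\<forall>\<phi>::_ \<Rightarrow> real. sum_list (map \<phi> \<xi>') = sum_list (map \<phi> \<xi>) + sum_list (map \<phi> \<zeta>))"
proof -
  have "u \<in> verts G" using z by auto
  then obtain \<xi>1 \<xi>2 where s: "\<xi> = \<xi>1 @ \<xi>2" "admissible \<xi>1" "admissible \<xi>2"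
     "awalk x (map fst \<xi>1) u" "awalk u (map fst \<xi>2) y"
    by (rule exhaustingE[OF ex])
  define \<xi>' where "\<xi>' = \<xi>1 @ \<zeta> @ \<xi>2"
  have "\<exists>\<eta>1 \<eta>2. \<xi>' = \<eta>1 @ \<eta>2 \<and> admissible \<eta>1 \<and> admissible \<eta>2 \<and>
     awalk x (map fst \<eta>1) v \<and> awalk v (map fst \<eta>2) y" if v: "v \<in> verts G" for v
  proof -
    obtain \<eta>1 \<eta>2 where e: "\<xi> = \<eta>1 @ \<eta>2" "admissible \<eta>1" "admissible \<eta>2"
     "awalk x (map fst \<eta>1) v" "awalk v (map fst \<eta>2) y"
      by (rule exhaustingE[OF ex v])
    have "\<xi>1 @ \<xi>2 = \<eta>1 @ \<eta>2" using s e by simp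
    then consider c where "\<xi>1 = \<eta>1 @ c" | c where "\<eta>1 = \<xi>1 @ c" "\<xi>2 = c @ \<eta>2"
      using append_eq_append_conv2[of \<xi>1 \<xi>2 \<eta>1 \<eta>2] by blast
    then show ?thesis
    proof cases
      case 1
      have ac: "admissible c" using admissible_suffix e(2) s(2) 1 by blast
      have "awalk v (map fst c) u" using awalk_suffix[OF e(4)] s(4) 1 by (simp only: map_append)
      then have "awalk v (map fst (c @ \<zeta> @ \<xi>2)) y"
        unfolding map_append using z s(5) by (blast intro: awalk_appendI)
      moreover have "admissible (c @ \<zeta> @ \<xi>2)" using ac z s by (blast intro: admissible_append)
      moreover have "\<xi>' = \<eta>1 @ (c @ \<zeta> @ \<xi>2)" using 1 by (simp add: \<xi>'_def)
      ultimately show ?thesis using e(2,4) by blast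
    next
      case 2
      have ac: "admissible c" using admissible_suffix e(2) s(2) 2 by blast
      have "awalk u (map fst c) v" using awalk_suffix[OF s(4)] e(4) 2 by (simp only: map_append)
      then have "awalk x (map fst (\<xi>1 @ \<zeta> @ c)) v"
        unfolding map_append using z s(4) by (blast intro: awalk_appendI)
      moreover have "admissible (\<xi>1 @ \<zeta> @ c)" using ac z s by (blast intro: admissible_append)
      moreover have "\<xi>' = (\<xi>1 @ \<zeta> @ c) @ \<eta>2" using 2 by (simp add: \<xi>'_def)
      ultimately show ?thesis using e(3,5) by blast
    qed
  qed
  moreover have "\<xi>' \<noteq> []" using ex s(1) by (auto simp: exhausting_def \<xi>'_def)
  ultimately have "exhausting x \<xi>' y" unfolding exhausting_def by blast
  moreover have "sum_list (map \<phi> \<xi>') = sum_list (map \<phi> \<xi>) + sum_list (map \<phi> \<zeta>)"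
    for \<phi> :: "_ \<Rightarrow> real" by (simp add: \<xi>'_def s(1))
  ultimately show ?thesis by blast
qed

lemma exhausting_insert_family:
  assumes ex: "exhausting x \<xi> y" and "finite I"
    and "\<And>i. i \<in> I \<Longrightarrow> \<exists>u. awalk u (map fst (\<zeta> i)) u" "\<And>i. i \<in> I \<Longrightarrow> admissible (\<zeta> i)"
  shows "\<exists>\<xi>'. exhausting x \<xi>' y \<and>
    (\<forall>\<phi>::_ \<Rightarrow> real. sum_list (map \<phi> \<xi>') = sum_list (map \<phi> \<xi>) + (\<Sum>i\<in>I. sum_list (map \<phi> (\<zeta> i))))"
  using assms(2-)
proof (induction I)
  case empty
  then show ?case using ex by auto
next
  case (insert i I)
  then obtain \<xi>' where x: "exhausting x \<xi>' y"
    "\<And>\<phi>::_ \<Rightarrow> real. sum_list (map \<phi> \<xi>') = sum_list (map \<phi> \<xi>) + (\<Sum>i\<in>I. sum_list (map \<phi> (\<zeta> i)))"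
    by (metis insertCI)
  obtain u where "awalk u (map fst (\<zeta> i)) u" using insert by blast
  then obtain \<xi>'' where "exhausting x \<xi>'' y"
    "\<And>\<phi>::_ \<Rightarrow> real. sum_list (map \<phi> \<xi>'') = sum_list (map \<phi> \<xi>') + sum_list (map \<phi> (\<zeta> i))"
    using exhausting_insert[OF x(1)] insert by (meson insertCI)
  then show ?case using x insert by (intro exI[of _ \<xi>'']) (auto simp: algebra_simps)
qed

lemma admissible_moving_list:
  "(\<And>e. e \<in> set p \<Longrightarrow> 0 < w e) \<Longrightarrow> admissible (map (\<lambda>e. (e, w e, 1 / w e)) p)"
  by (induction p) (auto intro: admissible.intros)

text \<open>At positive speeds the list may be cut anywhere, and a walk through all edges meets all
  vertices.\<close>

lemma exhausting_moving_list:
  assumes p: "awalk x p y" "arcs G \<subseteq> set p" and w: "\<And>e. e \<in> set p \<Longrightarrow> 0 < w e"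
  shows "exhausting x (map (\<lambda>e. (e, w e, 1 / w e)) p) y"
  unfolding exhausting_def
proof (intro conjI ballI)
  show "map (\<lambda>e. (e, w e, 1 / w e)) p \<noteq> []" using p arcs_nonempty by auto
  fix v assume v: "v \<in> verts G"
  have "v \<in> set (awalk_verts x p)"
  proof -
    \<comment> \<open>Some edge has \<open>v\<close> as an end: the last edge of a tree walk to
      \<open>v\<close>, or \<open>e\<close> itself if that walk is empty.\<close>
    obtain e u where e: "e \<in> arcs G" "u \<in> verts G" "tail G e = u" using arcs_nonempty tail_in_verts by blast
    obtain q where q: "awalk u q v" using tree_awalk e v by blast
    show ?thesis
    proof (cases "q = []")
      case True
      then have "tail G e = v" using q e by (auto simp: awalk_simps)
      then show ?thesis using awalk_verts_arc1[of e p x] p e by auto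
    next
      case False
      then have "last q \<in> arcs G" using q last_in_set[of q] unfolding awalk_def by blast
      moreover have "head G (last q) = v"
        using False awlast_of_awalk[OF q] q by (auto simp: awalk_verts_conv)
      ultimately show ?thesis using awalk_verts_arc2[OF p(1), of "last q"] p(2) by auto
    qed
  qed
  then obtain q r where qr: "p = q @ r" "awalk x q v" "awalk v r y"
    using awalk_decomp[OF p(1)] by meson
  let ?m = "map (\<lambda>e. (e, w e, 1 / w e))"
  have "map fst (?m p) = p" for p by (simp add: o_def)
  moreover have "admissible (?m q)" "admissible (?m r)"
    using w qr(1) by (auto intro!: admissible_moving_list)
  ultimately have "?m p = ?m q @ ?m r \<and> admissible (?m q) \<and> admissible (?m r) \<and>
      awalk x (map fst (?m q)) v \<and> awalk v (map fst (?m r)) y"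
    by (simp only: qr map_append simp_thms)
  then show "\<exists>\<xi>1 \<xi>2. ?m p = \<xi>1 @ \<xi>2 \<and> admissible \<xi>1 \<and> admissible \<xi>2 \<and>
      awalk x (map fst \<xi>1) v \<and> awalk v (map fst \<xi>2) y" by meson
qed

end

section \<open>The discrete Lagrangian\<close>

context hamiltonian_graph
begin

section \<open>Level and sublevel sets of the Hamiltonian\<close>

lemma H_cont: "e \<in> arcs G \<Longrightarrow> s \<in> {0..1} \<Longrightarrow> continuous_on A (H e s)"
  using H_C1 C1_differentiable_imp_continuous_on continuous_on_subset by blast

lemma H_ge_linear:
  assumes "e \<in> arcs G"
  shows "\<exists>R>0. \<forall>s\<in>{0..1}. \<forall>\<rho>\<ge>R. K * \<rho> \<le> H e s \<rho>"
proof -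
  obtain N where N: "\<forall>\<rho>\<ge>N. \<forall>s\<in>{0..1}. K \<le> H e s \<rho> / \<rho>"
    using H_superlinear[OF assms] by (auto simp: eventually_at_top_linorder)
  show ?thesis
  proof (intro exI[of _ "max N 1"] conjI ballI allI impI)
    fix s \<rho> :: real assume s: "s \<in> {0..1}" and r: "max N 1 \<le> \<rho>"
    then have "K \<le> H e s \<rho> / \<rho>" using N by auto
    then show "K * \<rho> \<le> H e s \<rho>" using r by (simp add: field_simps)
  qed simp
qed

text \<open>Growth at minus infinity is growth at plus infinity for the reversed edge.\<close>

lemma H_ge_linear_neg:
  assumes "e \<in> arcs G"
  shows "\<exists>R>0. \<forall>s\<in>{0..1}. \<forall>\<rho>\<le>-R. - K * \<rho> \<le> H e s \<rho>"
proof -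
  obtain R where R: "R > 0" "\<forall>s\<in>{0..1}. \<forall>\<rho>\<ge>R. K * \<rho> \<le> H (arev e) s \<rho>"
    using H_ge_linear[of "arev e" K] assms by auto
  have "- K * \<rho> \<le> H e s \<rho>" if "s \<in> {0..1}" "\<rho> \<le> -R" for s \<rho>
  proof -
    have "1 - s \<in> {0..1}" "R \<le> - \<rho>" using that by auto
    then have "K * (- \<rho>) \<le> H (arev e) (1 - s) (- \<rho>)" using R(2) by blast
    then show ?thesis using H_reversal[OF assms, of "1 - s" "- \<rho>"] that by simp
  qed
  then show ?thesis using R(1) by blast
qed

lemma H_attains_min:
  assumes e: "e \<in> arcs G" and s: "s \<in> {0..1}"
  shows "\<exists>\<rho>0. \<forall>\<rho>. H e s \<rho>0 \<le> H e s \<rho>"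
proof -
  \<comment> \<open>With this slope and \<open>B \<ge> 1\<close>, the function is at least
    \<open>H e s 0\<close> outside \<open>{-B..B}\<close>, so the minimum over the compact interval
    is global.\<close>
  obtain R where R: "R > 0" "\<forall>s'\<in>{0..1}. \<forall>\<rho>\<ge>R. \<bar>H e s 0\<bar> * \<rho> \<le> H e s' \<rho>"
    using H_ge_linear[OF e, of "\<bar>H e s 0\<bar>"] by blast
  obtain R' where R': "R' > 0" "\<forall>s'\<in>{0..1}. \<forall>\<rho>\<le>-R'. - \<bar>H e s 0\<bar> * \<rho> \<le> H e s' \<rho>"
    using H_ge_linear_neg[OF e, of "\<bar>H e s 0\<bar>"] by blast
  define B where "B = max 1 (max R R')"
  have B: "B \<ge> 1" "B \<ge> R" "B \<ge> R'" by (auto simp: B_def)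
  obtain \<rho>0 where r: "\<rho>0 \<in> {-B..B}" "\<forall>\<rho>\<in>{-B..B}. H e s \<rho>0 \<le> H e s \<rho>"
    using continuous_attains_inf[of "{-B..B}" "H e s"] H_cont[OF e s] B by auto
  have "H e s \<rho>0 \<le> H e s \<rho>" for \<rho>
  proof -
    have 0: "H e s \<rho>0 \<le> H e s 0" using r B by auto
    consider "\<rho> \<in> {-B..B}" | "\<rho> > B" | "\<rho> < -B" by fastforce
    then show ?thesis
    proof cases
      case 2
      then have "\<bar>H e s 0\<bar> * \<rho> \<le> H e s \<rho>" using R(2) s B by auto
      moreover have "\<bar>H e s 0\<bar> * 1 \<le> \<bar>H e s 0\<bar> * \<rho>" using 2 B by (intro mult_left_mono) auto
      ultimately show ?thesis using 0 by linarith
    next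
      case 3
      then have "- \<bar>H e s 0\<bar> * \<rho> \<le> H e s \<rho>" using R'(2) s B by auto
      moreover have "\<bar>H e s 0\<bar> * 1 \<le> \<bar>H e s 0\<bar> * (-\<rho>)" using 3 B by (intro mult_left_mono) auto
      ultimately show ?thesis using 0 by auto
    qed (use r in auto)
  qed
  then show ?thesis by blast
qed

lemma bdd_below_H: "e \<in> arcs G \<Longrightarrow> s \<in> {0..1} \<Longrightarrow> bdd_below (range (H e s))"
  using H_attains_min[of e s] by (auto simp: bdd_below_def)

text \<open>The supremum in \<open>min_level\<close> is a genuine one because the minima lie below
  the bounded function \<open>\<lambda>s. H e s 0\<close>. Hence no level from
  \<open>min_level e\<close> on has an empty sublevel set at any \<open>s\<close>.\<close>

lemma H_le_min_level:
  assumes e: "e \<in> arcs G" and s: "s \<in> {0..1}"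
  shows "\<exists>\<rho>. H e s \<rho> \<le> min_level e"
proof -
  obtain \<rho>0 where r: "\<And>\<rho>. H e s \<rho>0 \<le> H e s \<rho>" using H_attains_min[OF assms] by blast
  have "bdd_above ((\<lambda>s. H e s 0) ` {0..1})"
    using H_continuous[OF e] by (intro bounded_imp_bdd_above compact_imp_bounded compact_continuous_image) auto
  then obtain M where M: "\<And>s. s \<in> {0..1} \<Longrightarrow> H e s 0 \<le> M" unfolding bdd_above_def by blast
  have "bdd_above ((\<lambda>s. INF \<rho>. H e s \<rho>) ` {0..1})"
  proof (rule bdd_aboveI2)
    fix s :: real assume s: "s \<in> {0..1}"
    have "(INF \<rho>. H e s \<rho>) \<le> H e s 0" using bdd_below_H[OF e s] by (intro cINF_lower) auto
    then show "(INF \<rho>. H e s \<rho>) \<le> M" using M[OF s] by linarith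
  qed
  then have "(INF \<rho>. H e s \<rho>) \<le> min_level e" unfolding min_level_def using s by (intro cSUP_upper)
  moreover have "H e s \<rho>0 \<le> (INF \<rho>. H e s \<rho>)" using r by (intro cINF_greatest) auto
  ultimately show ?thesis using order_trans by blast
qed

lemma H_reaches:
  assumes e: "e \<in> arcs G" and s: "s \<in> {0..1}" and le: "H e s \<rho> \<le> a"
  shows "\<exists>\<rho>'\<ge>\<rho>. H e s \<rho>' = a"
proof -
  obtain R where R: "R > 0" "\<forall>s\<in>{0..1}. \<forall>\<rho>\<ge>R. \<bar>a\<bar> * \<rho> \<le> H e s \<rho>"
    using H_ge_linear[OF e, of "\<bar>a\<bar>"] by blast
  define z where "z = max \<rho> (max R 1)"
  have "\<bar>a\<bar> * 1 \<le> \<bar>a\<bar> * z" by (intro mult_left_mono) (auto simp: z_def)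
  also have "\<dots> \<le> H e s z" using R(2) s by (auto simp: z_def)
  finally have "a \<le> H e s z" by linarith
  then show ?thesis using IVT'[of "H e s" \<rho> a z] le H_cont[OF e s] by (force simp: z_def)
qed

text \<open>A point of the sublevel set has a point of the level set on its right
  (\<open>H_reaches\<close>), so \<open>sigma_plus a e s\<close> is the right end of the whole
  sublevel set. This is the form in which it is compared with other momenta.\<close>

lemma sigma_plus:
  assumes e: "e \<in> arcs G" and s: "s \<in> {0..1}" and a: "min_level e \<le> a"
  shows H_sigma_plus: "H e s (sigma_plus a e s) = a"
    and le_sigma_plus: "H e s \<rho> \<le> a \<Longrightarrow> \<rho> \<le> sigma_plus a e s"
proof -
  let ?S = "{\<rho>. H e s \<rho> = a}"
  obtain \<rho>1 where "H e s \<rho>1 \<le> a" using H_le_min_level[OF e s] a order_trans by blast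
  then have ne: "?S \<noteq> {}" using H_reaches[OF e s] by blast
  \<comment> \<open>The added 1 makes \<open>H\<close> strictly larger than \<open>a\<close> beyond
    \<open>max R 1\<close>.\<close>
  obtain R where R: "R > 0" "\<forall>s\<in>{0..1}. \<forall>\<rho>\<ge>R. (\<bar>a\<bar> + 1) * \<rho> \<le> H e s \<rho>"
    using H_ge_linear[OF e, of "\<bar>a\<bar> + 1"] by blast
  have bdd: "bdd_above ?S"
  proof (rule bdd_aboveI)
    fix \<rho> assume "\<rho> \<in> ?S"
    show "\<rho> \<le> max R 1"
    proof (rule ccontr)
      assume n: "\<not> \<rho> \<le> max R 1"
      then have "(\<bar>a\<bar> + 1) * 1 \<le> (\<bar>a\<bar> + 1) * \<rho>" by (intro mult_left_mono) auto
      also have "\<dots> \<le> H e s \<rho>" using R(2) s n by auto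
      finally show False using \<open>\<rho> \<in> ?S\<close> by auto
    qed
  qed
  have "closed ?S"
    using continuous_closed_preimage_constant[of UNIV "H e s" a] H_cont[OF e s] by simp
  then have "Sup ?S \<in> ?S" by (rule closed_contains_Sup[OF ne bdd])
  then show "H e s (sigma_plus a e s) = a" by (simp add: sigma_plus_def)
  show "\<rho> \<le> sigma_plus a e s" if le: "H e s \<rho> \<le> a"
  proof -
    obtain \<rho>' where "\<rho>' \<ge> \<rho>" "\<rho>' \<in> ?S" using H_reaches[OF e s le] by blast
    moreover have "\<rho>' \<le> Sup ?S" using \<open>\<rho>' \<in> ?S\<close> bdd by (rule cSup_upper)
    ultimately show ?thesis by (simp add: sigma_plus_def)
  qed
qed

lemma H_between:
  assumes e: "e \<in> arcs G" and s: "s \<in> {0..1}" and "x < y" "y < z"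
  shows "H e s y < max (H e s x) (H e s z)"
proof -
  define r where "r = (y - x) / (z - x)"
  have r: "0 < r" "r < 1" using assms by (auto simp: r_def)
  have "r * (z - x) = y - x" using assms by (simp add: r_def)
  then have y: "y = (1 - r) * x + r * z" by (simp add: algebra_simps)
  have "H e s y < (1 - r) * H e s x + r * H e s z"
    unfolding y using H_strictly_convex[OF e s _ r] assms by auto
  also have "\<dots> \<le> (1 - r) * max (H e s x) (H e s z) + r * max (H e s x) (H e s z)"
    using r by (intro add_mono mult_left_mono) auto
  finally show ?thesis by (simp add: algebra_simps)
qed

lemma H_mono_right:
  assumes "e \<in> arcs G" "s \<in> {0..1}" "x < y" "H e s x < H e s y" "y \<le> z"
  shows "H e s y \<le> H e s z"
  using H_between[OF assms(1,2,3), of z] assms(4,5) by (cases "y = z") auto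

lemma H_mono_left:
  assumes "e \<in> arcs G" "s \<in> {0..1}" "x < y" "H e s y < H e s x" "z \<le> x"
  shows "H e s x \<le> H e s z"
  using H_between[OF assms(1,2), of z x y] assms(3-5) by (cases "z = x") auto

text \<open>Continuity of \<open>H\<close> in \<open>s\<close> is available at one fixed momentum at
  a time. So the values at two fixed momenta, \<open>\<sigma>0\<close> and \<open>c\<close>, are
  compared near \<open>(a0, s0)\<close>, and convexity then decides on which side of
  \<open>c\<close> the right end of the sublevel set lies.\<close>

lemma continuous_sigma_plus:
  assumes e: "e \<in> arcs G"
  shows "continuous_on ({min_level e..} \<times> {0..1}) (\<lambda>(a, s). sigma_plus a e s)"
  unfolding continuous_on_def
proof
  fix p assume p: "p \<in> {min_level e..} \<times> {0..1::real}"
  let ?D = "{min_level e..} \<times> {0..1::real}"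
  obtain a0 s0 where p0: "p = (a0, s0)" "min_level e \<le> a0" "s0 \<in> {0..1}" using p by auto
  let ?F = "at p within ?D"
  let ?\<sigma> = "\<lambda>(a, s). sigma_plus a e s"
  define \<sigma>0 where "\<sigma>0 = sigma_plus a0 e s0"
  have \<sigma>0: "H e s0 \<sigma>0 = a0" "\<And>\<rho>. H e s0 \<rho> \<le> a0 \<Longrightarrow> \<rho> \<le> \<sigma>0"
    using sigma_plus[OF e p0(3,2)] by (auto simp: \<sigma>0_def)
  have inD: "\<forall>\<^sub>F x in ?F. x \<in> ?D" by (auto simp: eventually_at_filter)
  have cH: "((\<lambda>x. H e (snd x) \<rho>) \<longlongrightarrow> H e s0 \<rho>) ?F" for \<rho>
  proof -
    have "continuous_on ?D (\<lambda>x. H e (snd x) \<rho>)"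
      by (rule continuous_on_compose2[OF H_continuous[OF e]]) (auto intro!: continuous_intros)
    then show ?thesis using p p0 unfolding continuous_on_def by fastforce
  qed
  have ca: "(fst \<longlongrightarrow> a0) ?F" using p0 by (auto intro!: tendsto_eq_intros)
  have below: "\<forall>\<^sub>F x in ?F. H e (snd x) \<rho> < fst x" if "H e s0 \<rho> < a0" for \<rho>
    using order_tendstoD(1)[OF tendsto_diff[OF ca cH[of \<rho>]], of 0] that by simp
  have above: "\<forall>\<^sub>F x in ?F. fst x < H e (snd x) \<rho>" if "H e s0 \<rho> > a0" for \<rho>
    using order_tendstoD(1)[OF tendsto_diff[OF cH[of \<rho>] ca], of 0] that by simp
  have above': "\<forall>\<^sub>F x in ?F. H e (snd x) \<sigma>0 < H e (snd x) \<rho>" if "H e s0 \<rho> > a0" for \<rho>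
    using order_tendstoD(1)[OF tendsto_diff[OF cH[of \<rho>] cH[of \<sigma>0]], of 0] that \<sigma>0 by simp
  have "(?\<sigma> \<longlongrightarrow> \<sigma>0) ?F"
  proof (rule order_tendstoI)
    fix c assume c: "\<sigma>0 < c"
    then have ac: "a0 < H e s0 c" using \<sigma>0(2)[of c] by force
    show "\<forall>\<^sub>F x in ?F. ?\<sigma> x < c"
      using inD above[OF ac] above'[OF ac]
    proof eventually_elim
      case (elim x)
      obtain a s where x: "x = (a, s)" by force
      have as: "min_level e \<le> a" "s \<in> {0..1}" using elim x by auto
      show ?case
      proof (rule ccontr)
        assume "\<not> ?\<sigma> x < c"
        then have "H e s c \<le> H e s (sigma_plus a e s)"
          using H_mono_right[OF e as(2) c] elim x by simp
        then show False using H_sigma_plus[OF e as(2,1)] elim x by simp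
      qed
    qed
  next
    fix c assume c: "c < \<sigma>0"
    have lower: "\<forall>\<^sub>F x in ?F. c < ?\<sigma> x" if "H e s0 \<rho> < a0" "c \<le> \<rho>" for \<rho>
      using inD below[OF that(1)]
    proof eventually_elim
      case (elim x)
      obtain a s where x: "x = (a, s)" by force
      have as: "min_level e \<le> a" "s \<in> {0..1}" using elim x by auto
      have "\<rho> \<le> sigma_plus a e s" using le_sigma_plus[OF e as(2,1)] elim x by simp
      moreover have "\<rho> \<noteq> sigma_plus a e s" using H_sigma_plus[OF e as(2,1)] elim x by auto
      ultimately show ?case using that x by simp
    qed
    \<comment> \<open>\<open>c\<close> is inside the sublevel set, at its left end, or to the left
      of all of it. At the left end strict convexity makes the midpoint with
      \<open>\<sigma>0\<close> an interior point. The last case includes sublevel sets that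
      degenerate to the point \<open>\<sigma>0\<close>.\<close>
    consider "H e s0 c < a0" | "H e s0 c = a0" | "a0 < H e s0 c" by linarith
    then show "\<forall>\<^sub>F x in ?F. c < ?\<sigma> x"
    proof cases
      case 1
      then show ?thesis using lower by blast
    next
      case 2
      then have "H e s0 ((c + \<sigma>0) / 2) < a0"
        using H_between[OF e p0(3), of c "(c + \<sigma>0) / 2" \<sigma>0] c \<sigma>0 by (simp add: field_simps)
      then show ?thesis using lower c by (simp add: field_simps)
    next
      case 3
      show ?thesis using inD above[OF 3] above'[OF 3]
      proof eventually_elim
        case (elim x)
        obtain a s where x: "x = (a, s)" by force
        have as: "min_level e \<le> a" "s \<in> {0..1}" using elim x by auto
        show ?case
        proof (rule ccontr)
          assume "\<not> c < ?\<sigma> x"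
          then have "H e s c \<le> H e s (sigma_plus a e s)"
            using H_mono_left[OF e as(2) c] elim x by simp
          then show False using H_sigma_plus[OF e as(2,1)] elim x by simp
        qed
      qed
    qed
  qed
  then show "(?\<sigma> \<longlongrightarrow> ?\<sigma> p) ?F" by (simp add: p0 \<sigma>0_def)
qed

lemma continuous_sigma_plus_s:
  assumes "e \<in> arcs G" "min_level e \<le> a"
  shows "continuous_on {0..1} (sigma_plus a e)"
proof -
  have "continuous_on {0..1} ((\<lambda>(a, s). sigma_plus a e s) \<circ> (\<lambda>s. (a, s)))"
    using assms by (intro continuous_on_compose continuous_intros
      continuous_on_subset[OF continuous_sigma_plus[OF assms(1)]]) auto
  then show ?thesis by (simp add: o_def)
qed

section \<open>The averaged momentum as a function of the level\<close>

lemma sigma_plus_integrable: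
  "e \<in> arcs G \<Longrightarrow> min_level e \<le> a \<Longrightarrow> sigma_plus a e integrable_on {0..1}"
  using continuous_sigma_plus_s integrable_continuous_interval by blast

lemma sigma_int_le:
  assumes "e \<in> arcs G" "min_level e \<le> a" "\<And>s. s \<in> {0..1} \<Longrightarrow> sigma_plus a e s \<le> B"
  shows "sigma_int e a \<le> B"
  using integral_le[OF sigma_plus_integrable[OF assms(1,2)], of "\<lambda>_. B"] assms(3)
  by (simp add: sigma_int_def integrable_const_ivl)

lemma sigma_int_ge:
  assumes "e \<in> arcs G" "min_level e \<le> a" "\<And>s. s \<in> {0..1} \<Longrightarrow> B \<le> sigma_plus a e s"
  shows "B \<le> sigma_int e a"
  using integral_le[OF _ sigma_plus_integrable[OF assms(1,2)], of "\<lambda>_. B"] assms(3)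
  by (simp add: sigma_int_def integrable_const_ivl)

lemma sigma_int_strict_mono:
  assumes e: "e \<in> arcs G" and a: "min_level e \<le> a" "a < a'"
  shows "sigma_int e a < sigma_int e a'"
proof -
  have a': "min_level e \<le> a'" using a by simp
  have "sigma_plus a e s < sigma_plus a' e s" if s: "s \<in> {0..1}" for s
  proof -
    have "sigma_plus a e s \<le> sigma_plus a' e s"
      using le_sigma_plus[OF e s a', of "sigma_plus a e s"] H_sigma_plus[OF e s a(1)] a by simp
    moreover have "sigma_plus a e s \<noteq> sigma_plus a' e s"
      using H_sigma_plus[OF e s a(1)] H_sigma_plus[OF e s a'] a by auto
    ultimately show ?thesis by simp
  qed
  then show ?thesis unfolding sigma_int_def
    using continuous_sigma_plus_s[OF e a(1)] continuous_sigma_plus_s[OF e a']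
    by (intro integral_less_real) auto
qed

text \<open>At a level above the maximum of \<open>H e s B\<close> over \<open>s\<close>, the
  momentum \<open>B\<close> lies in every sublevel set.\<close>

lemma sigma_int_unbounded:
  assumes e: "e \<in> arcs G"
  shows "\<exists>a\<ge>a0. min_level e \<le> a \<and> B \<le> sigma_int e a"
proof -
  have "bdd_above ((\<lambda>s. H e s B) ` {0..1})"
    using H_continuous[OF e] by (intro bounded_imp_bdd_above compact_imp_bounded compact_continuous_image) auto
  then obtain M where M: "\<And>s. s \<in> {0..1} \<Longrightarrow> H e s B \<le> M" unfolding bdd_above_def by blast
  define a where "a = max a0 (max M (min_level e))"
  have "B \<le> sigma_plus a e s" if "s \<in> {0..1}" for s
    using le_sigma_plus[OF e that] M[OF that] by (auto simp: a_def)
  then have "B \<le> sigma_int e a" using sigma_int_ge[OF e, of a B] by (auto simp: a_def)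
  then show ?thesis by (intro exI[of _ a]) (auto simp: a_def)
qed

lemma continuous_sigma_int:
  assumes "e \<in> arcs G"
  shows "continuous_on {min_level e..} (sigma_int e)"
  using integral_continuous_on_param[of "{min_level e..}" 0 1 "\<lambda>a. sigma_plus a e"]
    continuous_sigma_plus[OF assms] unfolding sigma_int_def by simp

lemma sigma_int_surj:
  assumes e: "e \<in> arcs G"
  shows "sigma_int e ` {min_level e..} = {min_momentum e..}"
proof (intro equalityI subsetI)
  fix \<rho> assume "\<rho> \<in> sigma_int e ` {min_level e..}"
  then show "\<rho> \<in> {min_momentum e..}"
    using sigma_int_strict_mono[OF e order_refl] by (force simp: min_momentum_def le_less)
next
  fix \<rho> assume r: "\<rho> \<in> {min_momentum e..}"
  obtain a where a: "min_level e \<le> a" "\<rho> \<le> sigma_int e a" using sigma_int_unbounded[OF e] by blast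
  have "continuous_on {min_level e..a} (sigma_int e)"
    using continuous_on_subset[OF continuous_sigma_int[OF e]] by auto
  then show "\<rho> \<in> sigma_int e ` {min_level e..}"
    using IVT'[of "sigma_int e" "min_level e" \<rho> a] a r by (auto simp: min_momentum_def)
qed

lemma discrete_ham_sigma_int:
  assumes "e \<in> arcs G" "min_level e \<le> a"
  shows "discrete_ham e (sigma_int e a) = a"
  unfolding discrete_ham_def
proof (rule the_inv_into_f_f)
  show "inj_on (sigma_int e) {min_level e..}"
    by (rule linorder_inj_onI') (use sigma_int_strict_mono[OF assms(1)] in force)
qed (use assms in auto)

text \<open>
  Parametrizing momenta by energy levels avoids the inverse function.
\<close>

lemma discrete_lag_eq:
  assumes e: "e \<in> arcs G"
  shows "discrete_lag e v = (SUP a\<in>{min_level e..}. sigma_int e a * v - a)"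
  unfolding discrete_lag_def sigma_int_surj[OF e, symmetric] image_image
  using discrete_ham_sigma_int[OF e] by (intro arg_cong[of _ _ Sup] image_cong) auto

section \<open>Finiteness and bounds of the discrete Lagrangian\<close>

lemma bdd_above_lag:
  assumes e: "e \<in> arcs G" and v: "0 \<le> v"
  shows "bdd_above ((\<lambda>a. sigma_int e a * v - a) ` {min_level e..})"
proof -
  \<comment> \<open>Growth with slope \<open>v + 1\<close> bounds the momentum at level
    \<open>a\<close> by \<open>max R (a / (v + 1))\<close>; multiplied by \<open>v\<close>, the
    second entry is at most \<open>a\<close> when it is the larger one. The term with
    \<open>min_level e\<close> covers negative levels.\<close>
  obtain R where R: "R > 0" "\<forall>s\<in>{0..1}. \<forall>\<rho>\<ge>R. (v + 1) * \<rho> \<le> H e s \<rho>"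
    using H_ge_linear[OF e, of "v + 1"] by blast
  have "sigma_int e a * v - a \<le> R * v + \<bar>min_level e\<bar>" if a: "min_level e \<le> a" for a
  proof -
    have "sigma_plus a e s \<le> max R (a / (v + 1))" if s: "s \<in> {0..1}" for s
      using R(2) s H_sigma_plus[OF e s a] v
      by (cases "R \<le> sigma_plus a e s") (force simp: field_simps le_max_iff_disj)+
    then have "sigma_int e a \<le> max R (a / (v + 1))" using sigma_int_le[OF e a] by blast
    then have "sigma_int e a * v \<le> max R (a / (v + 1)) * v" using v by (rule mult_right_mono)
    also have "\<dots> \<le> R * v + \<bar>min_level e\<bar> + a"
    proof (cases "R \<le> a / (v + 1)")
      case True
      then have "0 \<le> a" using R(1) v by (smt (verit) divide_nonpos_pos)
      then have "a / (v + 1) * v \<le> a" using v by (simp add: field_simps)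
      then show ?thesis using True \<open>R > 0\<close> v by (simp add: max_def add_increasing)
    next
      case False
      then show ?thesis using a by (simp add: max_def)
    qed
    finally show ?thesis by simp
  qed
  then show ?thesis by (intro bdd_aboveI2) auto
qed

lemma discrete_lag_ge:
  "e \<in> arcs G \<Longrightarrow> 0 \<le> v \<Longrightarrow> min_level e \<le> a \<Longrightarrow> sigma_int e a * v - a \<le> discrete_lag e v"
  unfolding discrete_lag_eq by (rule cSUP_upper) (auto intro: bdd_above_lag)

lemma discrete_lag_approx:
  assumes "e \<in> arcs G" "0 \<le> v" "0 < \<epsilon>"
  shows "\<exists>a\<ge>min_level e. discrete_lag e v - \<epsilon> \<le> sigma_int e a * v - a"
proof (rule ccontr)
  assume n: "\<not> ?thesis"
  have "discrete_lag e v \<le> discrete_lag e v - \<epsilon>"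
    by (subst discrete_lag_eq[OF assms(1)], rule cSUP_least) (use n in force)+
  then show False using assms by simp
qed

lemma discrete_lag_0:
  assumes "e \<in> arcs G"
  shows "discrete_lag e 0 = - min_level e"
proof (rule antisym)
  show "discrete_lag e 0 \<le> - min_level e"
    by (subst discrete_lag_eq[OF assms(1)], rule cSUP_least) auto
  show "- min_level e \<le> discrete_lag e 0"
    using discrete_lag_ge[OF assms, of 0 "min_level e"] by simp
qed

text \<open>The substitution of \<open>1 - s\<close> for \<open>s\<close> and
  \<open>- \<rho>\<close> for \<open>\<rho>\<close> permutes the values. The lemma makes
  \<open>discrete_lag\<close> respect the identification of \<open>(e, 0)\<close> with
  \<open>(arev e, 0)\<close> in the cone.\<close>

lemma min_level_arev:
  assumes e: "e \<in> arcs G"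
  shows "min_level (arev e) = min_level e"
proof -
  have "(INF \<rho>. H (arev e) s \<rho>) = (INF \<rho>. H e (1 - s) \<rho>)" if "s \<in> {0..1}" for s
  proof -
    have "range (H (arev e) s) = H e (1 - s) ` range uminus"
      unfolding image_image using H_reversal[OF e that] by (intro image_cong) auto
    then show ?thesis by (simp only: surj_uminus)
  qed
  then have "(\<lambda>s. INF \<rho>. H (arev e) s \<rho>) ` {0..1} = (\<lambda>s. INF \<rho>. H e s \<rho>) ` ((-) 1 ` {0..1})"
    unfolding image_image by (intro image_cong) auto
  also have "(-) 1 ` {0..1::real} = {0..1}" by simp
  finally show ?thesis by (simp add: min_level_def)
qed

lemma discrete_lag_0_arev: "e \<in> arcs G \<Longrightarrow> discrete_lag (arev e) 0 = discrete_lag e 0"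
  by (simp add: discrete_lag_0 min_level_arev)

text \<open>This line comes from the lowest level, \<open>min_level e\<close>. It will bound what is
  lost when motion is replaced by rest.\<close>

lemma discrete_lag_ge_tangent_0:
  "e \<in> arcs G \<Longrightarrow> 0 \<le> v \<Longrightarrow> min_momentum e * v + discrete_lag e 0 \<le> discrete_lag e v"
  using discrete_lag_ge[of e v "min_level e"] by (simp add: discrete_lag_0 min_momentum_def)

text \<open>A level \<open>a\<close> with \<open>0 \<le> sigma_int e a\<close> yields a line that
  stays above \<open>- a\<close> at all nonnegative speeds.\<close>

lemma discrete_lag_bounded_below:
  "\<exists>K\<ge>0. \<forall>e\<in>arcs G. \<forall>v\<ge>0. - K \<le> discrete_lag e v"
proof -
  have "\<exists>K\<ge>0. \<forall>v\<ge>0. - K \<le> discrete_lag e v" if e: "e \<in> arcs G" for e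
  proof -
    obtain a where a: "a \<ge> 0" "min_level e \<le> a" "0 \<le> sigma_int e a"
      using sigma_int_unbounded[OF e, of 0 0] by blast
    have "- a \<le> discrete_lag e v" if "v \<ge> 0" for v
      using discrete_lag_ge[OF e that a(2)] mult_nonneg_nonneg[OF a(3) that] by linarith
    then show ?thesis using a by blast
  qed
  then obtain K where K: "\<And>e. e \<in> arcs G \<Longrightarrow> 0 \<le> K e \<and> (\<forall>v\<ge>0. - K e \<le> discrete_lag e v)" by metis
  have le: "K e \<le> (\<Sum>e\<in>arcs G. K e)" if "e \<in> arcs G" for e
    using that K by (intro member_le_sum) auto
  show ?thesis
  proof (intro exI[of _ "\<Sum>e\<in>arcs G. K e"] conjI ballI allI impI)
    show "0 \<le> (\<Sum>e\<in>arcs G. K e)" using K by (intro sum_nonneg) auto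
    show "- (\<Sum>e\<in>arcs G. K e) \<le> discrete_lag e v" if "e \<in> arcs G" "0 \<le> v" for e v
      using K[OF that(1)] le[OF that(1)] that(2) by force
  qed
qed

text \<open>Each line in the supremum is largest at an end of the interval: at \<open>V\<close> if
  its slope is nonnegative, at 0 otherwise.\<close>

lemma discrete_lag_bounded_above:
  assumes V: "0 \<le> V"
  shows "\<exists>C\<ge>0. \<forall>e\<in>arcs G. \<forall>v\<in>{0..V}. discrete_lag e v \<le> C"
proof -
  define C where "C = (\<Sum>e\<in>arcs G. \<bar>discrete_lag e V\<bar> + \<bar>min_level e\<bar>)"
  have "discrete_lag e v \<le> C" if e: "e \<in> arcs G" and v: "v \<in> {0..V}" for e v
  proof -
    have "sigma_int e a * v - a \<le> \<bar>discrete_lag e V\<bar> + \<bar>min_level e\<bar>" if a: "min_level e \<le> a" for a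
    proof (cases "sigma_int e a \<ge> 0")
      case True
      then have "sigma_int e a * v \<le> sigma_int e a * V" using v by (intro mult_left_mono) auto
      then show ?thesis using discrete_lag_ge[OF e V a] by linarith
    next
      case False
      then have "sigma_int e a * v \<le> 0" using v by (intro mult_nonpos_nonneg) auto
      then show ?thesis using a by linarith
    qed
    then have "discrete_lag e v \<le> \<bar>discrete_lag e V\<bar> + \<bar>min_level e\<bar>"
      unfolding discrete_lag_eq[OF e, of v] by (intro cSUP_least) auto
    also have "\<dots> \<le> C" unfolding C_def using e by (intro member_le_sum) auto
    finally show ?thesis .
  qed
  moreover have "0 \<le> C" unfolding C_def by (intro sum_nonneg) auto
  ultimately show ?thesis by blast
qed

end

section \<open>Masses and fluxes of measures on the tangent cone\<close>

text \<open>The image measure sits on finitely many measurable points, so an arbitrary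
  \<open>g\<close> agrees almost everywhere with the simple function \<open>g'\<close>. In this way
  the Lagrangian and the distance can be integrated as they stand.\<close>

lemma nn_integral_distr_point_measure:
  fixes g :: "'b \<Rightarrow> ennreal"
  assumes I: "finite I" and f: "f \<in> I \<rightarrow> space M" and sing: "\<And>i. i \<in> I \<Longrightarrow> {f i} \<in> sets M"
  shows "(\<integral>\<^sup>+ x. g x \<partial>distr (point_measure I w) M f) = (\<Sum>i\<in>I. w i * g (f i))"
proof -
  let ?N = "point_measure I w"
  let ?D = "distr ?N M f"
  have fm [measurable]: "f \<in> measurable ?N M" using f by simp
  have fin: "finite (f ` I)" using I by simp
  define g' where "g' = (\<lambda>x. \<Sum>y\<in>f ` I. g y * indicator {y} x)"
  have g'm [measurable]: "g' \<in> borel_measurable M"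
    unfolding g'_def using sing by (intro borel_measurable_sum borel_measurable_times_ennreal) auto
  have g'f: "g' x = g x" if "x \<in> f ` I" for x
  proof -
    have "g' x = (\<Sum>y\<in>f ` I. if y = x then g y else 0)"
      unfolding g'_def by (intro sum.cong) (auto simp: indicator_def)
    then show ?thesis using that fin by simp
  qed
  have "f ` I = (\<Union>i\<in>I. {f i})" by auto
  also have "\<dots> \<in> sets M" using sing I by (intro sets.finite_UN) auto
  finally have "f ` I \<in> sets M" .
  moreover have "{x \<in> space M. x \<in> f ` I} = f ` I" using funcset_mem[OF f] by auto
  ultimately have "(AE x in ?D. x \<in> f ` I) \<longleftrightarrow> (AE i in ?N. f i \<in> f ` I)"
    by (intro AE_distr_iff fm) simp
  moreover have "AE i in ?N. f i \<in> f ` I" by (rule AE_I2) (simp add: space_point_measure)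
  ultimately have "AE x in ?D. x \<in> f ` I" by simp
  then have "AE x in ?D. g x = g' x" by eventually_elim (simp add: g'f)
  then have "(\<integral>\<^sup>+ x. g x \<partial>?D) = (\<integral>\<^sup>+ x. g' x \<partial>?D)" by (rule nn_integral_cong_AE)
  also have "\<dots> = (\<integral>\<^sup>+ i. g' (f i) \<partial>?N)" by (rule nn_integral_distr[OF fm]) simp
  also have "\<dots> = (\<Sum>i\<in>I. w i * g' (f i))" using I by (rule nn_integral_point_measure_finite)
  finally show ?thesis by (simp add: g'f)
qed

lemma sum_list_map_nth: "sum_list (map \<phi> xs) = (\<Sum>i<length xs. \<phi> (xs ! i))"
  by (simp add: sum_list_sum_nth atLeast0LessThan)

context rotation_graph
begin

interpretation cone: Metric_space tangent_cone cone_dist by (rule Metric_space_cone)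

lemma space_cone_borel [simp]: "space cone_borel = tangent_cone"
  unfolding cone_borel_def by (rule space_measure_of) (use openin_subset in fastforce)

lemma sets_cone_borel: "sets cone_borel = sigma_sets tangent_cone {U. openin cone.mtopology U}"
  unfolding cone_borel_def by (rule sets_measure_of) (use openin_subset in fastforce)

lemma openin_sets_cone_borel: "openin cone.mtopology U \<Longrightarrow> U \<in> sets cone_borel"
  unfolding sets_cone_borel by (rule sigma_sets.Basic) simp

lemma singleton_sets_cone_borel:
  assumes "X \<in> tangent_cone"
  shows "{X} \<in> sets cone_borel"
proof -
  have "closedin cone.mtopology {X}"
    using assms by (intro closedin_Hausdorff_singleton cone.Hausdorff_space_mtopology) simp
  then have "openin cone.mtopology (tangent_cone - {X})" by (simp add: closedin_def)
  then have "tangent_cone - (tangent_cone - {X}) \<in> sets cone_borel"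
    using sets.compl_sets[of _ cone_borel] openin_sets_cone_borel by fastforce
  then show ?thesis using assms by (simp add: double_diff)
qed

lemma nonexpansive_borel_measurable:
  fixes g :: "_ \<Rightarrow> real"
  assumes g: "\<And>X Y. X \<in> tangent_cone \<Longrightarrow> Y \<in> tangent_cone \<Longrightarrow> \<bar>g X - g Y\<bar> \<le> cone_dist X Y"
  shows "g \<in> borel_measurable cone_borel"
proof (rule borel_measurableI_greater)
  fix a
  have "openin cone.mtopology {X \<in> tangent_cone. a < g X}"
    unfolding cone.openin_mtopology
  proof (intro conjI allI impI)
    fix X assume X: "X \<in> {X \<in> tangent_cone. a < g X}"
    have "cone.mball X (g X - a) \<subseteq> {X \<in> tangent_cone. a < g X}"
      using g[of X] by (force simp: cone.in_mball)
    then show "\<exists>r>0. cone.mball X r \<subseteq> {X \<in> tangent_cone. a < g X}"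
      using X by (intro exI[of _ "g X - a"]) simp
  qed auto
  then show "{X \<in> space cone_borel. a < g X} \<in> sets cone_borel"
    using openin_sets_cone_borel by simp
qed

lemma lift_point:
  assumes "e \<in> arcs G" "0 \<le> q" "q = 0 \<Longrightarrow> g (arev e) 0 = g e 0"
  shows "lift g (point e q) = g e q"
proof -
  have "(\<lambda>(e, q). g e q) ` point e q = {g e q}"
    using assms by (auto simp: point_eq)
  then show ?thesis by (simp add: lift_def)
qed

lemma cone_cases:
  assumes "X \<in> tangent_cone"
  obtains e q where "e \<in> arcs G" "0 \<le> q" "X = point e q"
  using cone_point[OF assms] by blast

text \<open>The function vanishes at rest, so it respects the identification in the cone. It is
  nonexpansive, which is what lets its integral, the flux, pass to Wasserstein limits.\<close>

definition edge_speed :: "'e \<Rightarrow> ('e \<times> real) set \<Rightarrow> real" where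
  "edge_speed e = lift (\<lambda>e' q. if e' = e then q else 0)"

definition flux :: "('e \<times> real) set measure \<Rightarrow> 'e \<Rightarrow> real" where
  "flux \<mu> e = (\<integral>X. edge_speed e X \<partial>\<mu>)"

lemma edge_speed_point:
  "e' \<in> arcs G \<Longrightarrow> 0 \<le> q \<Longrightarrow> edge_speed e (point e' q) = (if e' = e then q else 0)"
  unfolding edge_speed_def by (subst lift_point) auto

lemma speed_point: "e \<in> arcs G \<Longrightarrow> 0 \<le> q \<Longrightarrow> lift (\<lambda>e q. q) (point e q) = q"
  by (subst lift_point) auto

lemma edge_speed_nonneg: "X \<in> tangent_cone \<Longrightarrow> 0 \<le> edge_speed e X"
  by (erule cone_cases) (simp add: edge_speed_point)

lemma edge_speed_le: "X \<in> tangent_cone \<Longrightarrow> edge_speed e X \<le> lift (\<lambda>e q. q) X"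
  by (erule cone_cases) (simp add: edge_speed_point speed_point)

lemma edge_speed_nonexpansive:
  assumes "X \<in> tangent_cone" "Y \<in> tangent_cone"
  shows "\<bar>edge_speed e X - edge_speed e Y\<bar> \<le> cone_dist X Y"
  using assms(1)
proof (rule cone_cases)
  fix e1 q1 assume X: "e1 \<in> arcs G" "0 \<le> q1" "X = point e1 q1"
  from assms(2) show ?thesis
  proof (rule cone_cases)
    fix e2 q2 assume Y: "e2 \<in> arcs G" "0 \<le> q2" "Y = point e2 q2"
    show ?thesis using X Y by (auto simp: edge_speed_point cone_dist_point pair_dist_def)
  qed
qed

lemma edge_speed_measurable [measurable]: "edge_speed e \<in> borel_measurable cone_borel"
  by (rule nonexpansive_borel_measurable) (rule edge_speed_nonexpansive)

lemma speed_measurable [measurable]: "lift (\<lambda>e q. q) \<in> borel_measurable cone_borel"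
proof (rule nonexpansive_borel_measurable)
  fix X Y assume "X \<in> tangent_cone" "Y \<in> tangent_cone"
  from this(1) show "\<bar>lift (\<lambda>e q. q) X - lift (\<lambda>e q. q) Y\<bar> \<le> cone_dist X Y"
  proof (rule cone_cases)
    fix e1 q1 assume X: "e1 \<in> arcs G" "0 \<le> q1" "X = point e1 q1"
    from \<open>Y \<in> tangent_cone\<close> show ?thesis
    proof (rule cone_cases)
      fix e2 q2 assume Y: "e2 \<in> arcs G" "0 \<le> q2" "Y = point e2 q2"
      show ?thesis using X Y by (auto simp: speed_point cone_dist_point pair_dist_def)
    qed
  qed
qed

lemma prob_measuresD:
  assumes "\<mu> \<in> prob_measures"
  shows "sets \<mu> = sets cone_borel" "space \<mu> = tangent_cone" "prob_space \<mu>"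
    "integrable \<mu> (lift (\<lambda>e q. q))"
  using assms sets_eq_imp_space_eq[of \<mu> cone_borel] by (auto simp: prob_measures_def)

lemma edge_speed_integrable:
  assumes "\<mu> \<in> prob_measures"
  shows "integrable \<mu> (edge_speed e)"
proof (rule Bochner_Integration.integrable_bound)
  note mu = prob_measuresD[OF assms]
  show "integrable \<mu> (lift (\<lambda>e q. q))" by (rule mu)
  show "edge_speed e \<in> borel_measurable \<mu>" by (simp cong: measurable_cong_sets add: mu(1))
  show "AE X in \<mu>. norm (edge_speed e X) \<le> norm (lift (\<lambda>e q. q) X)"
  proof (rule AE_I2)
    fix X assume "X \<in> space \<mu>"
    then show "norm (edge_speed e X) \<le> norm (lift (\<lambda>e q. q) X)"
      using edge_speed_nonneg[of X e] edge_speed_le[of X e] mu(2) by simp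
  qed
qed

lemma flux_nonneg: "\<mu> \<in> prob_measures \<Longrightarrow> 0 \<le> flux \<mu> e"
  unfolding flux_def using edge_speed_nonneg prob_measuresD(2) by (intro integral_nonneg_AE AE_I2) auto

lemma measure_rotation_flux:
  assumes "\<mu> \<in> prob_measures"
  shows "measure_rotation \<mu> i = (\<Sum>e\<in>arcs G. of_int (theta e i) * flux \<mu> e)"
proof -
  note mu = prob_measuresD[OF assms]
  have "lift (\<lambda>e q. q * of_int (theta e i)) X = (\<Sum>e\<in>arcs G. of_int (theta e i) * edge_speed e X)"
    if "X \<in> tangent_cone" for X
    using that
  proof (rule cone_cases)
    fix e q assume X: "e \<in> arcs G" "0 \<le> q" "X = point e q"
    have "(\<Sum>e'\<in>arcs G. of_int (theta e' i) * edge_speed e' X) =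
        (\<Sum>e'\<in>arcs G. if e' = e then of_int (theta e' i) * q else 0)"
      using X by (intro sum.cong) (auto simp: edge_speed_point)
    then show ?thesis using X by (simp add: lift_point)
  qed
  then have "measure_rotation \<mu> i = (\<integral>X. (\<Sum>e\<in>arcs G. of_int (theta e i) * edge_speed e X) \<partial>\<mu>)"
    unfolding measure_rotation_def using mu(2) by (intro Bochner_Integration.integral_cong) auto
  also have "\<dots> = (\<Sum>e\<in>arcs G. of_int (theta e i) * flux \<mu> e)"
    unfolding flux_def using edge_speed_integrable[OF assms]
    by (subst Bochner_Integration.integral_sum) auto
  finally show ?thesis .
qed

text \<open>The easy half of Kantorovich duality: a coupling of cost below \<open>\<epsilon>\<close>
  exists, and the nonexpansive \<open>edge_speed e\<close> changes along it by at most the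
  cost.\<close>

lemma flux_wasserstein:
  assumes mu: "\<mu> \<in> prob_measures" and nu: "\<nu> \<in> prob_measures"
    and W: "wasserstein \<mu> \<nu> < ennreal \<epsilon>"
  shows "\<bar>flux \<mu> e - flux \<nu> e\<bar> < \<epsilon>"
proof -
  obtain \<pi> where p: "\<pi> \<in> couplings \<mu> \<nu>" and d: "(\<integral>\<^sup>+ (X, Y). ennreal (cone_dist X Y) \<partial>\<pi>) < ennreal \<epsilon>"
    using W unfolding wasserstein_def by (auto simp: INF_less_iff)
  have sp: "sets \<pi> = sets (cone_borel \<Otimes>\<^sub>M cone_borel)"
    and m1: "distr \<pi> cone_borel fst = \<mu>" and m2: "distr \<pi> cone_borel snd = \<nu>"
    using p by (auto simp: couplings_def)
  have [measurable]: "fst \<in> measurable \<pi> cone_borel" "snd \<in> measurable \<pi> cone_borel"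
    by (auto cong: measurable_cong_sets simp: sp)
  have spc: "space \<pi> = tangent_cone \<times> tangent_cone"
    using sets_eq_imp_space_eq[OF sp] by (simp add: space_pair_measure)
  have f1: "flux \<mu> e = (\<integral>p. edge_speed e (fst p) \<partial>\<pi>)"
    unfolding flux_def m1[symmetric] by (rule integral_distr) auto
  have f2: "flux \<nu> e = (\<integral>p. edge_speed e (snd p) \<partial>\<pi>)"
    unfolding flux_def m2[symmetric] by (rule integral_distr) auto
  have i1: "integrable \<pi> (\<lambda>p. edge_speed e (fst p))"
    using edge_speed_integrable[OF mu, of e] unfolding m1[symmetric] by (subst (asm) integrable_distr_eq) auto
  have i2: "integrable \<pi> (\<lambda>p. edge_speed e (snd p))"
    using edge_speed_integrable[OF nu, of e] unfolding m2[symmetric] by (subst (asm) integrable_distr_eq) auto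
  have "ennreal \<bar>flux \<mu> e - flux \<nu> e\<bar> = ennreal (norm (\<integral>p. edge_speed e (fst p) - edge_speed e (snd p) \<partial>\<pi>))"
    using i1 i2 by (simp add: f1 f2)
  also have "\<dots> \<le> (\<integral>\<^sup>+ p. ennreal (norm (edge_speed e (fst p) - edge_speed e (snd p))) \<partial>\<pi>)"
    using i1 i2 by (intro integral_norm_bound_ennreal) auto
  also have "\<dots> \<le> (\<integral>\<^sup>+ (X, Y). ennreal (cone_dist X Y) \<partial>\<pi>)"
    using edge_speed_nonexpansive spc by (intro nn_integral_mono) (auto intro!: ennreal_leI)
  also note d
  finally show ?thesis by (simp add: ennreal_less_iff)
qed

text \<open>The equilibrium point is shared by \<open>e\<close> and \<open>arev e\<close>, so each
  orientation receives half of it. With this convention the masses of all edges add up to 1.\<close>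

definition mass_density :: "'e \<Rightarrow> ('e \<times> real) set \<Rightarrow> real" where
  "mass_density e X = indicator {X \<in> tangent_cone. 0 < edge_speed e X} X + indicator {point e 0} X / 2"

definition mass :: "('e \<times> real) set measure \<Rightarrow> 'e \<Rightarrow> real" where
  "mass \<mu> e = (\<integral>X. mass_density e X \<partial>\<mu>)"

lemma mass_density_measurable [measurable]:
  "e \<in> arcs G \<Longrightarrow> mass_density e \<in> borel_measurable cone_borel"
proof -
  assume e: "e \<in> arcs G"
  have "{X \<in> space cone_borel. 0 < edge_speed e X} \<in> sets cone_borel" by measurable
  moreover have "{point e 0} \<in> sets cone_borel"
    using singleton_sets_cone_borel point_in_cone[OF e] by simp
  ultimately show ?thesis unfolding mass_density_def
    by (intro borel_measurable_add borel_measurable_divide borel_measurable_indicator) auto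
qed

lemma point_0_eq_iff:
  "e \<in> arcs G \<Longrightarrow> e' \<in> arcs G \<Longrightarrow> 0 \<le> q \<Longrightarrow>
    point e' q = point e 0 \<longleftrightarrow> q = 0 \<and> (e' = e \<or> e' = arev e)"
  using arev_neq[of e] arev_neq[of e'] by (auto simp: point_eq doubleton_eq_iff)

lemma mass_density_point:
  assumes "e \<in> arcs G" "e' \<in> arcs G" "0 \<le> q"
  shows "mass_density e (point e' q) =
    (if 0 < q then if e' = e then 1 else 0 else if e' = e \<or> e' = arev e then 1 / 2 else 0)"
  using assms point_in_cone[of e' q]
  by (auto simp: mass_density_def edge_speed_point point_0_eq_iff indicator_def)

lemma mass_density_bounds: "0 \<le> mass_density e X" "mass_density e X \<le> 2"
  by (auto simp: mass_density_def indicator_def)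

lemma mass_density_integrable:
  assumes "\<mu> \<in> prob_measures" "e \<in> arcs G"
  shows "integrable \<mu> (mass_density e)"
proof -
  note mu = prob_measuresD[OF assms(1)]
  interpret prob_space \<mu> by (rule mu)
  have "mass_density e \<in> borel_measurable \<mu>"
    using mass_density_measurable[OF assms(2)] by (simp cong: measurable_cong_sets add: mu(1))
  then show ?thesis
    by (intro integrable_const_bound[of _ 2]) (use mass_density_bounds in \<open>auto simp: abs_of_nonneg\<close>)
qed

lemma mass_nonneg: "0 \<le> mass \<mu> e"
  unfolding mass_def using mass_density_bounds by (intro integral_nonneg_AE AE_I2) auto

lemma sum_mass_density_point:
  assumes e: "e \<in> arcs G" and q: "0 \<le> q"
  shows "(\<Sum>e'\<in>arcs G. c e' * mass_density e' (point e q)) =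
    (if 0 < q then c e else (c e + c (arev e)) / 2)"
proof (cases "0 < q")
  case True
  have "(\<Sum>e'\<in>arcs G. c e' * mass_density e' (point e q)) = (\<Sum>e'\<in>arcs G. if e' = e then c e' else 0)"
    using e q True by (intro sum.cong) (auto simp: mass_density_point)
  then show ?thesis using True e by simp
next
  case False
  have "(\<Sum>e'\<in>arcs G. c e' * mass_density e' (point e q)) =
     (\<Sum>e'\<in>arcs G. (if e' = e then c e' / 2 else 0) + (if e' = arev e then c e' / 2 else 0))"
  proof (rule sum.cong)
    fix e' assume "e' \<in> arcs G"
    moreover have "e = arev e' \<longleftrightarrow> e' = arev e" by (metis arev_arev)
    ultimately show "c e' * mass_density e' (point e q) =
        (if e' = e then c e' / 2 else 0) + (if e' = arev e then c e' / 2 else 0)"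
      using e q False arev_neq[OF e] by (auto simp: mass_density_point)
  qed simp
  then show ?thesis using False e by (simp add: sum.distrib add_divide_distrib)
qed

lemma sum_mass:
  assumes "\<mu> \<in> prob_measures"
  shows "(\<Sum>e\<in>arcs G. mass \<mu> e) = 1"
proof -
  note mu = prob_measuresD[OF assms(1)]
  interpret prob_space \<mu> by (rule mu)
  have "(\<Sum>e\<in>arcs G. mass_density e X) = 1" if "X \<in> tangent_cone" for X
    using that by (rule cone_cases) (use sum_mass_density_point[of _ _ "\<lambda>_. 1"] in simp)
  then have "(\<integral>X. (\<Sum>e\<in>arcs G. mass_density e X) \<partial>\<mu>) = (\<integral>X. 1 \<partial>\<mu>)"
    using mu(2) by (intro Bochner_Integration.integral_cong) auto
  then show ?thesis unfolding mass_def using mass_density_integrable[OF assms]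
    by (simp add: prob_space)
qed

text \<open>The density is 1 wherever the edge speed is positive. This gives
  \<open>flux \<mu> e = mass \<mu> e * (flux \<mu> e / mass \<mu> e)\<close> also where the quotient
  is 0 by convention.\<close>

lemma mass_eq_0_imp_flux_eq_0:
  assumes "\<mu> \<in> prob_measures" "e \<in> arcs G" "mass \<mu> e = 0"
  shows "flux \<mu> e = 0"
proof -
  note mu = prob_measuresD[OF assms(1)]
  have "AE X in \<mu>. mass_density e X = 0"
    using integral_nonneg_eq_0_iff_AE[OF mass_density_integrable[OF assms(1,2)]] assms(3) mass_density_bounds
    by (simp add: mass_def)
  moreover have "AE X in \<mu>. X \<in> tangent_cone" using mu(2) by (intro AE_I2) auto
  ultimately have "AE X in \<mu>. edge_speed e X = 0"
  proof eventually_elim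
    case (elim X)
    from elim(2) show ?case
      by (rule cone_cases) (use elim assms(2) in \<open>auto simp: edge_speed_point mass_density_point split: if_splits\<close>)
  qed
  then show ?thesis unfolding flux_def by (rule integral_eq_zero_AE)
qed

end

section \<open>Occupation measures and their action\<close>

context rotation_graph
begin

lemma admissible_elem:
  "admissible \<xi> \<Longrightarrow> (e, q, t) \<in> set \<xi> \<Longrightarrow> 0 \<le> q \<and> 0 < t \<and> (0 < q \<longrightarrow> t = 1 / q)"
  by (induction rule: admissible.induct) auto

lemma param_path_elem:
  assumes "param_path x \<xi> y" "(e, q, t) \<in> set \<xi>"
  shows "e \<in> arcs G" "0 \<le> q" "0 < t"
proof -
  have "set (map fst \<xi>) \<subseteq> arcs G" using assms(1) unfolding param_path_def awalk_def by blast
  then show "e \<in> arcs G" using assms(2) by force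
  show "0 \<le> q" "0 < t" using assms admissible_elem by (auto simp: param_path_def)
qed

lemma total_time_pos:
  assumes "param_path x \<xi> y"
  shows "0 < total_time \<xi>"
proof -
  have "(\<Sum>(e, q, t)\<leftarrow>\<xi>. t) > 0" if "\<xi> \<noteq> []" "\<And>e q t. (e, q, t) \<in> set \<xi> \<Longrightarrow> 0 < t"
    for \<xi> :: "('e \<times> real \<times> real) list"
    using that
  proof (induction \<xi> rule: list_nonempty_induct)
    case (cons x xs)
    obtain e q t where "x = (e, q, t)" by (cases x)
    then show ?case using cons.IH cons.prems by (auto intro!: add_pos_pos)
  qed auto
  then show ?thesis using assms param_path_elem(3)[OF assms] by (auto simp: total_time_def param_path_def)
qed

abbreviation occ_point :: "('e \<times> real \<times> real) list \<Rightarrow> nat \<Rightarrow> ('e \<times> real) set" where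
  "occ_point \<xi> i \<equiv> point (fst (\<xi> ! i)) (fst (snd (\<xi> ! i)))"

abbreviation occ_weight :: "('e \<times> real \<times> real) list \<Rightarrow> nat \<Rightarrow> real" where
  "occ_weight \<xi> i \<equiv> snd (snd (\<xi> ! i)) / total_time \<xi>"

lemma occ_point_in_cone:
  assumes "param_path x \<xi> y"
  shows "occ_point \<xi> \<in> {..<length \<xi>} \<rightarrow> tangent_cone"
  using param_path_elem(1,2)[OF assms] by (intro funcsetI point_in_cone) (auto simp: in_set_conv_nth, (metis prod.collapse)+)

lemma occ_weight_nonneg:
  assumes "param_path x \<xi> y" "i < length \<xi>"
  shows "0 \<le> occ_weight \<xi> i"
proof -
  have "\<xi> ! i \<in> set \<xi>" using assms(2) by simp
  then have "0 < snd (snd (\<xi> ! i))" using param_path_elem(3)[OF assms(1)] by (metis prod.collapse)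
  then show ?thesis using total_time_pos[OF assms(1)] by simp
qed

lemma sum_occ_weight:
  "(\<Sum>i<length \<xi>. occ_weight \<xi> i * \<phi> (occ_point \<xi> i)) =
    (\<Sum>(e, q, t)\<leftarrow>\<xi>. t * \<phi> (point e q)) / total_time \<xi>"
  by (simp add: sum_list_map_nth sum_divide_distrib split_beta)

text \<open>A construction by \<open>measure_of\<close> takes the prescribed values only if they
  form a measure. As the image of a weighted index set it is one, and its integrals become finite
  sums. Weights sit on positions because a path may repeat an entry.\<close>

lemma occupation_eq:
  assumes p: "param_path x \<xi> y"
  shows "occupation \<xi> = distr (point_measure {..<length \<xi>} (\<lambda>i. ennreal (occ_weight \<xi> i)))
    cone_borel (occ_point \<xi>)"
  unfolding occupation_def distr_def space_cone_borel
proof (rule measure_of_eq)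
  show "sets cone_borel \<subseteq> Pow tangent_cone" using sets.space_closed[of cone_borel] by simp
  fix S assume "S \<in> sigma_sets tangent_cone (sets cone_borel)"
  let ?I = "{..<length \<xi>}"
  let ?J = "occ_point \<xi> -` S \<inter> ?I"
  have "emeasure (point_measure ?I (\<lambda>i. ennreal (occ_weight \<xi> i))) ?J = (\<Sum>i\<in>?J. ennreal (occ_weight \<xi> i))"
    by (intro emeasure_point_measure_finite) auto
  also have "\<dots> = ennreal (\<Sum>i\<in>?J. occ_weight \<xi> i)"
    using occ_weight_nonneg[OF p] by (intro sum_ennreal) auto
  also have "(\<Sum>i\<in>?J. occ_weight \<xi> i) = (\<Sum>i\<in>?I. occ_weight \<xi> i * indicator S (occ_point \<xi> i))"
    by (intro sum.mono_neutral_cong_left) (auto simp: indicator_def split: if_splits)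
  also have "\<dots> = 1 / total_time \<xi> * (\<Sum>(e, q, t)\<leftarrow>\<xi>. t * indicator S (point e q))"
    by (simp only: sum_occ_weight[of \<xi> "indicator S"]) simp
  finally show "ennreal (1 / total_time \<xi> * (\<Sum>(e, q, t)\<leftarrow>\<xi>. t * indicator S (point e q))) =
      emeasure (point_measure ?I (\<lambda>i. ennreal (occ_weight \<xi> i)))
        (occ_point \<xi> -` S \<inter> space (point_measure ?I (\<lambda>i. ennreal (occ_weight \<xi> i))))"
    by (simp add: space_point_measure)
qed

lemma nn_integral_occupation:
  assumes p: "param_path x \<xi> y"
  shows "(\<integral>\<^sup>+ X. g X \<partial>occupation \<xi>) = (\<Sum>i<length \<xi>. ennreal (occ_weight \<xi> i) * g (occ_point \<xi> i))"
  unfolding occupation_eq[OF p] using occ_point_in_cone[OF p]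
  by (intro nn_integral_distr_point_measure) (auto intro!: singleton_sets_cone_borel)

lemma
  fixes g :: "_ \<Rightarrow> real"
  assumes p: "param_path x \<xi> y" and g: "g \<in> borel_measurable cone_borel"
  shows integrable_occupation: "integrable (occupation \<xi>) g"
    and integral_occupation:
      "(\<integral>X. g X \<partial>occupation \<xi>) = (\<Sum>(e, q, t)\<leftarrow>\<xi>. t * g (point e q)) / total_time \<xi>"
proof -
  let ?N = "point_measure {..<length \<xi>} (\<lambda>i. ennreal (occ_weight \<xi> i))"
  have f: "occ_point \<xi> \<in> measurable ?N cone_borel" using occ_point_in_cone[OF p] by simp
  show "integrable (occupation \<xi>) g"
    unfolding occupation_eq[OF p] integrable_distr_eq[OF f g]
    by (intro integrable_point_measure_finite) simp
  have "(\<integral>X. g X \<partial>occupation \<xi>) = (\<integral>i. g (occ_point \<xi> i) \<partial>?N)"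
    unfolding occupation_eq[OF p] by (rule integral_distr[OF f g])
  also have "\<dots> = (\<Sum>i<length \<xi>. occ_weight \<xi> i * g (occ_point \<xi> i))"
    using occ_weight_nonneg[OF p] by (subst lebesgue_integral_point_measure_finite) auto
  finally show "(\<integral>X. g X \<partial>occupation \<xi>) = (\<Sum>(e, q, t)\<leftarrow>\<xi>. t * g (point e q)) / total_time \<xi>"
    by (simp only: sum_occ_weight[of \<xi> g])
qed

lemma occupation_prob_measures:
  assumes p: "param_path x \<xi> y"
  shows "occupation \<xi> \<in> prob_measures"
proof -
  have "prob_space (point_measure {..<length \<xi>} (\<lambda>i. ennreal (occ_weight \<xi> i)))"
  proof (rule prob_space_point_measure)
    have "(\<Sum>i<length \<xi>. occ_weight \<xi> i) = total_time \<xi> / total_time \<xi>"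
      using sum_occ_weight[of \<xi> "\<lambda>_. 1"] by (simp add: total_time_def)
    then have 1: "(\<Sum>i<length \<xi>. occ_weight \<xi> i) = 1" using total_time_pos[OF p] by simp
    have "(\<Sum>i<length \<xi>. ennreal (occ_weight \<xi> i)) = ennreal (\<Sum>i<length \<xi>. occ_weight \<xi> i)"
      using occ_weight_nonneg[OF p] by (intro sum_ennreal) auto
    then show "(\<Sum>i<length \<xi>. ennreal (occ_weight \<xi> i)) = 1" by (simp only: 1 ennreal_1)
  qed auto
  then interpret N: prob_space "point_measure {..<length \<xi>} (\<lambda>i. ennreal (occ_weight \<xi> i))" .
  have "prob_space (occupation \<xi>)"
    unfolding occupation_eq[OF p] using occ_point_in_cone[OF p] by (intro N.prob_space_distr) simp
  moreover have "sets (occupation \<xi>) = sets cone_borel" by (simp add: occupation_eq[OF p])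
  ultimately show ?thesis
    using integrable_occupation[OF p speed_measurable] by (simp add: prob_measures_def)
qed

text \<open>Edges at speed 0 come in pairs \<open>e\<close>, \<open>arev e\<close>, so deleting them
  leaves a walk with the same ends and the same rotation. The edges that remain are those that carry
  flux.\<close>

definition moving_arcs :: "('e \<times> real \<times> real) list \<Rightarrow> 'e list" where
  "moving_arcs \<xi> = map fst (filter (\<lambda>(e, q, t). 0 < q) \<xi>)"

lemma moving_arcs_simps [simp]:
  "moving_arcs [] = []"
  "moving_arcs ((e, q, t) # \<xi>) = (if 0 < q then e # moving_arcs \<xi> else moving_arcs \<xi>)"
  by (simp_all add: moving_arcs_def)

text \<open>A moving entry contributes speed times time, \<open>q * (1 / q) = 1\<close>, so the flux
  counts traversals per unit of time. This links measures to the combinatorics of walks.\<close>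

lemma flux_occupation:
  assumes p: "param_path x \<xi> y"
  shows "flux (occupation \<xi>) e = count_list (moving_arcs \<xi>) e / total_time \<xi>"
proof -
  have arcs: "(e', q, t) \<in> set \<xi> \<Longrightarrow> e' \<in> arcs G" for e' q t using param_path_elem(1)[OF p] .
  have "admissible \<xi>" using p by (simp add: param_path_def)
  then have "(\<Sum>(e', q, t)\<leftarrow>\<xi>. t * edge_speed e (point e' q)) = count_list (moving_arcs \<xi>) e"
    using arcs
  proof (induction rule: admissible.induct)
    case (moving q \<xi> e')
    have "e' \<in> arcs G" by (rule moving.prems[of _ q "1 / q"]) simp
    moreover have "(\<Sum>(e', q, t)\<leftarrow>\<xi>. t * edge_speed e (point e' q)) = count_list (moving_arcs \<xi>) e"
      by (rule moving.IH) (use moving.prems in auto)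
    ultimately show ?case using moving(1) by (simp add: edge_speed_point)
  next
    case (equilibrium t t' \<xi> e')
    have "e' \<in> arcs G" by (rule equilibrium.prems[of _ 0 t]) simp
    moreover have "(\<Sum>(e', q, t)\<leftarrow>\<xi>. t * edge_speed e (point e' q)) = count_list (moving_arcs \<xi>) e"
      by (rule equilibrium.IH) (use equilibrium.prems in auto)
    ultimately show ?case by (simp add: edge_speed_point)
  qed simp
  then show ?thesis unfolding flux_def
    by (subst integral_occupation[OF p edge_speed_measurable]) simp
qed

lemma path_rotation_moving_arcs:
  "admissible \<xi> \<Longrightarrow> path_rotation (moving_arcs \<xi>) i = path_rotation (map fst \<xi>) i"
  by (induction rule: admissible.induct) (auto simp: path_rotation_Cons theta_arev)

lemma awalk_moving_arcs: "admissible \<xi> \<Longrightarrow> awalk x (map fst \<xi>) y \<Longrightarrow> awalk x (moving_arcs \<xi>) y"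
  by (induction arbitrary: x rule: admissible.induct) (auto simp: awalk_Cons_iff)

lemma path_rotation_count:
  assumes "set p \<subseteq> arcs G"
  shows "real_of_int (path_rotation p i) = (\<Sum>e\<in>arcs G. of_int (theta e i) * count_list p e)"
proof -
  have "path_rotation p i = (\<Sum>e\<in>arcs G. of_nat (count_list p e) * theta e i)"
    unfolding path_rotation_def by (rule sum_list_count[OF assms finite_arcs])
  then show ?thesis by (simp add: mult.commute)
qed

lemma rotation_occupation:
  assumes p: "param_path x \<xi> y"
  shows "measure_rotation (occupation \<xi>) i = path_rotation (map fst \<xi>) i / total_time \<xi>"
proof -
  have a: "admissible \<xi>" "awalk x (map fst \<xi>) y" using p by (auto simp: param_path_def)
  have "set (moving_arcs \<xi>) \<subseteq> arcs G" using awalk_moving_arcs[OF a] unfolding awalk_def by blast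
  then have "real_of_int (path_rotation (map fst \<xi>) i) =
      (\<Sum>e\<in>arcs G. of_int (theta e i) * count_list (moving_arcs \<xi>) e)"
    using path_rotation_count path_rotation_moving_arcs[OF a(1)] by metis
  then show ?thesis
    by (simp add: measure_rotation_flux[OF occupation_prob_measures[OF p]] flux_occupation[OF p]
        sum_divide_distrib)
qed

text \<open>The diagonal coupling has cost 0. This places the occupation measure of a cycle in the
  closure that defines \<open>closed_measures\<close>.\<close>

lemma wasserstein_occupation_self:
  assumes p: "param_path x \<xi> y"
  shows "wasserstein (occupation \<xi>) (occupation \<xi>) = 0"
proof -
  let ?N = "point_measure {..<length \<xi>} (\<lambda>i. ennreal (occ_weight \<xi> i))"
  let ?f = "\<lambda>i. (occ_point \<xi> i, occ_point \<xi> i)"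
  let ?P = "cone_borel \<Otimes>\<^sub>M cone_borel"
  let ?\<pi> = "distr ?N ?P ?f"
  have in_cone: "occ_point \<xi> i \<in> tangent_cone" if "i < length \<xi>" for i
    using funcset_mem[OF occ_point_in_cone[OF p]] that by simp
  have f: "?f \<in> measurable ?N ?P" using in_cone by (auto simp: space_pair_measure)
  have "distr ?\<pi> cone_borel fst = occupation \<xi>" "distr ?\<pi> cone_borel snd = occupation \<xi>"
    unfolding occupation_eq[OF p] by (subst distr_distr, use f in \<open>auto simp: o_def\<close>)+
  then have "?\<pi> \<in> couplings (occupation \<xi>) (occupation \<xi>)" by (simp add: couplings_def)
  then have "wasserstein (occupation \<xi>) (occupation \<xi>) \<le> (\<integral>\<^sup>+ (X, Y). ennreal (cone_dist X Y) \<partial>?\<pi>)"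
    unfolding wasserstein_def by (rule INF_lower)
  also have "\<dots> = (\<Sum>i<length \<xi>. ennreal (occ_weight \<xi> i) * (case ?f i of (X, Y) \<Rightarrow> ennreal (cone_dist X Y)))"
  proof (rule nn_integral_distr_point_measure)
    show "{?f i} \<in> sets ?P" if "i \<in> {..<length \<xi>}" for i
      using pair_measureI[of "{occ_point \<xi> i}" cone_borel "{occ_point \<xi> i}" cone_borel]
        singleton_sets_cone_borel[OF in_cone] that by simp
  qed (use in_cone in \<open>auto simp: space_pair_measure\<close>)
  also have "\<dots> = 0" using in_cone by (intro sum.neutral) (auto simp: Metric_space.mdist_zero[OF Metric_space_cone])
  finally show ?thesis by simp
qed

lemma occupation_closed_measures:
  assumes "param_path x \<xi> x"
  shows "occupation \<xi> \<in> closed_measures"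
  using occupation_prob_measures[OF assms] wasserstein_occupation_self[OF assms] assms
  by (auto simp: closed_measures_def intro!: exI[of _ x] exI[of _ \<xi>])

end

context hamiltonian_graph
begin

lemma lift_discrete_lag:
  "e \<in> arcs G \<Longrightarrow> 0 \<le> q \<Longrightarrow> lift discrete_lag (point e q) = discrete_lag e q"
  by (rule lift_point) (auto simp: discrete_lag_0_arev)

lemma measure_action_occupation:
  assumes p: "param_path x \<xi> y"
  shows "measure_action (occupation \<xi>) = ereal (path_action \<xi> / total_time \<xi>)"
proof -
  let ?w = "occ_weight \<xi>" and ?l = "\<lambda>i. lift discrete_lag (occ_point \<xi> i)"
  \<comment> \<open>\<open>ennreal\<close> sends negative reals to 0, so the two parts of the action
    become sums of \<open>max 0 (l i)\<close> and \<open>max 0 (- l i)\<close>, whose difference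
    restores \<open>l i\<close>.\<close>
  have *: "(\<Sum>i<length \<xi>. ennreal (?w i) * ennreal (l i)) = ennreal (\<Sum>i<length \<xi>. ?w i * max 0 (l i))"
    for l :: "nat \<Rightarrow> real"
  proof -
    have "(\<Sum>i<length \<xi>. ennreal (?w i) * ennreal (l i)) = (\<Sum>i<length \<xi>. ennreal (?w i * max 0 (l i)))"
      by (intro sum.cong refl) (simp only: ennreal_mult''[OF max.cobounded1] ennreal_max_0)
    also have "\<dots> = ennreal (\<Sum>i<length \<xi>. ?w i * max 0 (l i))"
      using occ_weight_nonneg[OF p] by (intro sum_ennreal mult_nonneg_nonneg) auto
    finally show ?thesis .
  qed
  have e: "enn2ereal (ennreal (\<Sum>i<length \<xi>. ?w i * max 0 (l i))) = ereal (\<Sum>i<length \<xi>. ?w i * max 0 (l i))"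
    for l :: "nat \<Rightarrow> real"
    using occ_weight_nonneg[OF p] by (intro enn2ereal_ennreal sum_nonneg mult_nonneg_nonneg) auto
  have "measure_action (occupation \<xi>) =
    ereal ((\<Sum>i<length \<xi>. ?w i * max 0 (?l i)) - (\<Sum>i<length \<xi>. ?w i * max 0 (- ?l i)))"
    unfolding measure_action_def nn_integral_occupation[OF p] * e by simp
  also have "(\<Sum>i<length \<xi>. ?w i * max 0 (?l i)) - (\<Sum>i<length \<xi>. ?w i * max 0 (- ?l i)) =
      (\<Sum>i<length \<xi>. ?w i * ?l i)"
    unfolding sum_subtractf[symmetric] by (intro sum.cong) (auto simp: max_def)
  also have "\<dots> = (\<Sum>(e, q, t)\<leftarrow>\<xi>. t * lift discrete_lag (point e q)) / total_time \<xi>"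
    by (rule sum_occ_weight)
  also have "(\<Sum>(e, q, t)\<leftarrow>\<xi>. t * lift discrete_lag (point e q)) = path_action \<xi>"
    unfolding path_action_def using param_path_elem(1,2)[OF p]
    by (intro arg_cong[of _ _ sum_list] map_cong) (auto simp: lift_discrete_lag)
  finally show ?thesis .
qed

text \<open>
  Jensen's inequality: \<open>\<lambda>q. d e * q + c e\<close> will be a supporting line of the Lagrangian at the mean
  speed on the edge \<open>e\<close>.
\<close>

lemma measure_action_ge:
  assumes mu: "\<mu> \<in> prob_measures"
    and L: "\<And>e q. e \<in> arcs G \<Longrightarrow> 0 \<le> q \<Longrightarrow> d e * q + c e \<le> discrete_lag e q"
  shows "ereal (\<Sum>e\<in>arcs G. d e * flux \<mu> e + c e * mass \<mu> e) \<le> measure_action \<mu>"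
proof -
  let ?L = "lift discrete_lag"
  define g where "g = (\<lambda>X. (\<Sum>e\<in>arcs G. d e * edge_speed e X) + (\<Sum>e\<in>arcs G. c e * mass_density e X))"
  note mu' = prob_measuresD[OF mu]
  have gL: "g X \<le> ?L X" if "X \<in> tangent_cone" for X
    using that
  proof (rule cone_cases)
    fix e q assume X: "e \<in> arcs G" "0 \<le> q" "X = point e q"
    have "(\<Sum>e'\<in>arcs G. d e' * edge_speed e' X) = (\<Sum>e'\<in>arcs G. if e' = e then d e' * q else 0)"
      using X by (intro sum.cong) (auto simp: edge_speed_point)
    then have d: "(\<Sum>e'\<in>arcs G. d e' * edge_speed e' X) = d e * q" using X by simp
    show ?thesis
    proof (cases "0 < q")
      case True
      then show ?thesis using X d L[of e q]
        by (simp add: g_def sum_mass_density_point lift_discrete_lag)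
    next
      case False
      \<comment> \<open>At rest \<open>g\<close> is the mean of \<open>c e\<close> and
        \<open>c (arev e)\<close>, both of which lie below the common value of the
        Lagrangian.\<close>
      then show ?thesis using X d L[of e 0] L[of "arev e" 0]
        by (simp add: g_def sum_mass_density_point lift_discrete_lag discrete_lag_0_arev)
    qed
  qed
  have ig: "integrable \<mu> g"
    unfolding g_def using edge_speed_integrable[OF mu] mass_density_integrable[OF mu]
    by (intro Bochner_Integration.integrable_add Bochner_Integration.integrable_sum
        Bochner_Integration.integrable_mult_right) auto
  have "(\<integral>X. g X \<partial>\<mu>) = (\<Sum>e\<in>arcs G. d e * flux \<mu> e + c e * mass \<mu> e)"
    unfolding g_def flux_def mass_def using edge_speed_integrable[OF mu] mass_density_integrable[OF mu]
    by (simp add: sum.distrib)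
  moreover have "ereal (\<integral>X. g X \<partial>\<mu>) \<le> measure_action \<mu>"
  proof -
    let ?p = "\<integral>\<^sup>+ X. ennreal (g X) \<partial>\<mu>" and ?n = "\<integral>\<^sup>+ X. ennreal (- g X) \<partial>\<mu>"
    let ?P = "\<integral>\<^sup>+ X. ennreal (?L X) \<partial>\<mu>" and ?N = "\<integral>\<^sup>+ X. ennreal (- ?L X) \<partial>\<mu>"
    have fin: "?p \<noteq> \<infinity>" "?n \<noteq> \<infinity>" using ig by (auto simp: real_integrable_def)
    have "?p \<le> ?P" "?N \<le> ?n"
      using gL mu'(2) by (auto intro!: nn_integral_mono ennreal_leI)
    then have "enn2ereal ?p - enn2ereal ?n \<le> enn2ereal ?P - enn2ereal ?N"
      by (intro ereal_minus_mono) (auto simp: less_eq_ennreal.rep_eq)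
    moreover have "enn2ereal ?p - enn2ereal ?n = ereal (\<integral>X. g X \<partial>\<mu>)"
      unfolding real_lebesgue_integral_def[OF ig] using fin
      by (cases ?p; cases ?n) (auto simp: enn2real_ennreal)
    ultimately show ?thesis by (simp add: measure_action_def)
  qed
  ultimately show ?thesis by simp
qed

end

section \<open>Comparison of the minimal action and the \<open>\<beta>\<close>-function\<close>

context hamiltonian_graph
begin

section \<open>Paths of bounded action per unit of time\<close>

lemma real_path_rotation:
  "real_of_int (path_rotation (map fst \<xi>) i) = (\<Sum>(e, q, t)\<leftarrow>\<xi>. real_of_int (theta e i))"
  by (induction \<xi>) (auto simp: path_rotation_Cons)

lemma path_action_ge:
  assumes p: "param_path x \<xi> y" and K: "\<And>e v. e \<in> arcs G \<Longrightarrow> 0 \<le> v \<Longrightarrow> - K \<le> discrete_lag e v"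
  shows "- K * total_time \<xi> \<le> path_action \<xi>"
proof -
  have "- K * total_time \<xi> = (\<Sum>(e, q, t)\<leftarrow>\<xi>. t * (- K))"
    by (simp add: total_time_def sum_list_map_nth split_beta sum_distrib_left mult.commute sum_negf)
  also have "\<dots> \<le> path_action \<xi>"
    unfolding path_action_def
  proof (rule sum_list_mono)
    fix z assume z: "z \<in> set \<xi>"
    obtain e q t where [simp]: "z = (e, q, t)" by (cases z)
    have "t * (- K) \<le> t * discrete_lag e q"
      using param_path_elem[OF p, of e q t] z K[of e q] by (intro mult_left_mono) auto
    then show "(case z of (e, q, t) \<Rightarrow> t * (- K)) \<le> (case z of (e, q, t) \<Rightarrow> t * discrete_lag e q)"
      by simp
  qed
  finally show ?thesis .
qed

text \<open>All edges are run at the one speed \<open>length p / S\<close>, so a bound for the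
  Lagrangian at that speed bounds the action.\<close>

lemma uniform_exhausting_path:
  assumes p: "awalk x p y" "arcs G \<subseteq> set p" and S: "0 < S"
    and C: "\<And>e. e \<in> arcs G \<Longrightarrow> discrete_lag e (length p / S) \<le> C"
  shows "\<exists>\<xi>. exhausting x \<xi> y \<and> map fst \<xi> = p \<and> total_time \<xi> = S \<and> path_action \<xi> \<le> S * C"
proof -
  define w where "w = length p / S"
  define \<xi> where "\<xi> = map (\<lambda>e. (e, w, 1 / w)) p"
  have "p \<noteq> []" using p(2) arcs_nonempty by auto
  then have w: "0 < w" using S by (simp add: w_def)
  have "exhausting x \<xi> y"
    unfolding \<xi>_def by (rule exhausting_moving_list[OF p]) (use w in auto)
  moreover have "map fst \<xi> = p" by (simp add: \<xi>_def o_def)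
  moreover have "total_time \<xi> = S"
    using \<open>p \<noteq> []\<close> S by (simp add: total_time_def \<xi>_def w_def o_def sum_list_triv)
  moreover have "path_action \<xi> \<le> S * C"
  proof -
    have pa: "set p \<subseteq> arcs G" using p by (auto simp: awalk_def)
    have "path_action \<xi> = (\<Sum>e\<leftarrow>p. 1 / w * discrete_lag e w)"
      by (simp add: path_action_def \<xi>_def o_def)
    also have "\<dots> \<le> (\<Sum>e\<leftarrow>p. 1 / w * C)"
      by (intro sum_list_mono mult_left_mono) (use C[folded w_def] pa w in auto)
    also have "\<dots> = S * C"
      using \<open>p \<noteq> []\<close> S by (simp add: sum_list_triv w_def)
    finally show ?thesis .
  qed
  ultimately show ?thesis by blast
qed

lemma
  assumes "awalk x (map fst \<omega>) x" "admissible \<omega>"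
  shows awalk_concat_replicate: "awalk x (map fst (concat (replicate j \<omega>))) x"
    and admissible_concat_replicate: "admissible (concat (replicate j \<omega>))"
proof -
  have "awalk x (map fst (concat (replicate j \<omega>))) x \<and> admissible (concat (replicate j \<omega>))"
  proof (induction j)
    case 0
    then show ?case using assms by (auto simp: awalk_simps admissible.nil)
  next
    case (Suc j)
    then show ?case using assms
      by (auto simp: admissible_append intro!: awalk_appendI simp del: awalk_append_iff)
  qed
  then show "awalk x (map fst (concat (replicate j \<omega>))) x" "admissible (concat (replicate j \<omega>))" by auto
qed

lemma sum_list_concat_replicate:
  "sum_list (map \<phi> (concat (replicate j \<omega>))) = real j * sum_list (map \<phi> \<omega>)"
  by (induction j) (auto simp: algebra_simps)

lemma sum_nat_abs_le:
  fixes h :: "nat \<Rightarrow> int" and B :: real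
  assumes "\<And>i. i < betti \<Longrightarrow> real_of_int \<bar>h i\<bar> \<le> B"
  shows "real (\<Sum>i<betti. nat \<bar>h i\<bar>) \<le> betti * B"
proof -
  have "real (\<Sum>i<betti. nat \<bar>h i\<bar>) = (\<Sum>i<betti. real_of_int \<bar>h i\<bar>)" by simp
  also have "\<dots> \<le> (\<Sum>i<betti. B)" using assms by (intro sum_mono) auto
  finally show ?thesis by simp
qed

text \<open>The walk has length linear in \<open>h\<close>, and \<open>1 \<le> S\<close> absorbs the
  constant term, so its uniform speed is at most \<open>V\<close>, whatever \<open>S\<close> and
  \<open>h\<close> are.\<close>

lemma uniform_path_with_rotation:
  assumes A: "0 \<le> A"
  shows "\<exists>C\<ge>0. \<forall>x\<in>verts G. \<forall>y\<in>verts G. \<forall>S\<ge>1. \<forall>h. (\<forall>i\<ge>betti. h i = 0) \<longrightarrow>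
    (\<forall>i<betti. real_of_int \<bar>h i\<bar> \<le> A * S) \<longrightarrow>
    (\<exists>\<xi>. exhausting x \<xi> y \<and> total_time \<xi> = S \<and> path_rotation (map fst \<xi>) = h \<and> path_action \<xi> \<le> S * C)"
proof -
  obtain M where M: "\<And>x y g. x \<in> verts G \<Longrightarrow> y \<in> verts G \<Longrightarrow> (\<forall>i\<ge>betti. g i = 0) \<Longrightarrow>
    (\<exists>p. awalk x p y \<and> path_rotation p = g \<and> arcs G \<subseteq> set p \<and>
       length p \<le> M * (1 + (\<Sum>i<betti. nat \<bar>g i\<bar>)))"
    using exhausting_walk_with_rotation by blast
  define V where "V = M * (1 + betti * A)"
  have "0 \<le> V" using A by (simp add: V_def)
  then obtain C where C: "C \<ge> 0" "\<And>e v. e \<in> arcs G \<Longrightarrow> v \<in> {0..V} \<Longrightarrow> discrete_lag e v \<le> C"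
    using discrete_lag_bounded_above by blast
  have "\<exists>\<xi>. exhausting x \<xi> y \<and> total_time \<xi> = S \<and> path_rotation (map fst \<xi>) = h \<and> path_action \<xi> \<le> S * C"
    if xy: "x \<in> verts G" "y \<in> verts G" and S: "1 \<le> S" and h: "\<forall>i\<ge>betti. h i = 0"
      "\<forall>i<betti. real_of_int \<bar>h i\<bar> \<le> A * S" for x y S h
  proof -
    obtain p where p: "awalk x p y" "path_rotation p = h" "arcs G \<subseteq> set p"
       "length p \<le> M * (1 + (\<Sum>i<betti. nat \<bar>h i\<bar>))"
      using M[OF xy h(1)] by blast
    have "real (length p) \<le> M * (1 + real (\<Sum>i<betti. nat \<bar>h i\<bar>))"
      using of_nat_mono[OF p(4), where 'a=real] by (simp add: algebra_simps)
    also have "\<dots> \<le> M * (S + betti * (A * S))"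
      using S sum_nat_abs_le[of h "A * S"] h(2) by (intro mult_left_mono add_mono) auto
    also have "\<dots> = V * S" by (simp add: V_def algebra_simps)
    finally have "length p / S \<le> V" using S by (simp add: field_simps)
    then have "discrete_lag e (length p / S) \<le> C" if "e \<in> arcs G" for e
      using C(2)[OF that] S by auto
    then show ?thesis using uniform_exhausting_path[OF p(1,3), of S C] S p(2) by auto
  qed
  then show ?thesis using C(1) by blast
qed

section \<open>From paths to cycles: bounding \<beta> by the minimal action\<close>

text \<open>
  Closing up the path takes one extra unit of time. After \<open>j \<approx> T / 2\<close> closed-up copies, \<open>h\<close> is realized
  once more in the time \<open>T - j\<close>, so that the whole cycle has mean rotation vector exactly \<open>h / T\<close>.
\<close>

lemma mather_beta_le:
  assumes A: "0 \<le> A"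
  shows "\<exists>C\<ge>0. \<forall>x\<in>verts G. \<forall>y\<in>verts G. \<forall>T\<ge>2. \<forall>h. \<forall>\<xi>. (\<forall>i\<ge>betti. h i = 0) \<longrightarrow>
    (\<forall>i<betti. real_of_int \<bar>h i\<bar> \<le> A * T) \<longrightarrow> param_path x \<xi> y \<longrightarrow> total_time \<xi> = T \<longrightarrow>
    path_rotation (map fst \<xi>) = h \<longrightarrow>
    mather_beta (\<lambda>i. of_int (h i) / T) \<le> ereal ((path_action \<xi> + C) / T)"
proof -
  obtain K where K: "K \<ge> 0" "\<And>e v. e \<in> arcs G \<Longrightarrow> 0 \<le> v \<Longrightarrow> - K \<le> discrete_lag e v"
    using discrete_lag_bounded_below by blast
  \<comment> \<open>The factor 2 is due to \<open>T - j \<ge> T / 2\<close>: the rotation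
    \<open>h\<close> has to fit into about half of the time.\<close>
  obtain C where C: "C \<ge> 0" "\<And>x y S h. x \<in> verts G \<Longrightarrow> y \<in> verts G \<Longrightarrow> 1 \<le> S \<Longrightarrow> (\<forall>i\<ge>betti. h i = 0) \<Longrightarrow>
    (\<forall>i<betti. real_of_int \<bar>h i\<bar> \<le> 2 * A * S) \<Longrightarrow>
    (\<exists>\<xi>. exhausting x \<xi> y \<and> total_time \<xi> = S \<and> path_rotation (map fst \<xi>) = h \<and> path_action \<xi> \<le> S * C)"
    using uniform_path_with_rotation[of "2 * A"] A by auto
  \<comment> \<open>Per copy, \<open>2 * K\<close> makes up for dividing the action of only
    \<open>j\<close> copies of \<open>\<xi>\<close> by \<open>j + 1\<close>, since that action is at
    least \<open>- K * T\<close>. One \<open>C\<close> pays for the closing path and two pay for the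
    share of \<open>\<eta>\<close>, because \<open>T \<le> 2 * (j + 1)\<close>.\<close>
  define C' where "C' = 2 * K + 3 * C"
  have "mather_beta (\<lambda>i. of_int (h i) / T) \<le> ereal ((path_action \<xi> + C') / T)"
    if xy: "x \<in> verts G" "y \<in> verts G" and T: "2 \<le> T" and h: "\<forall>i\<ge>betti. h i = 0"
      "\<forall>i<betti. real_of_int \<bar>h i\<bar> \<le> A * T" and \<xi>: "param_path x \<xi> y" "total_time \<xi> = T"
      "path_rotation (map fst \<xi>) = h" for x y T h \<xi>
  proof -
    define j where "j = nat \<lfloor>T / 2\<rfloor>"
    have "real j = of_int \<lfloor>T / 2\<rfloor>" using T by (simp add: j_def)
    then have j: "real j \<le> T / 2" "T / 2 < real j + 1" by linarith+
    obtain \<zeta> where \<zeta>: "exhausting y \<zeta> x" "total_time \<zeta> = 1" "path_rotation (map fst \<zeta>) = (\<lambda>i. 0)"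
      "path_action \<zeta> \<le> C"
      using C(2)[OF xy(2,1), of 1 "\<lambda>i. 0"] A by auto
    have "real_of_int \<bar>h i\<bar> \<le> 2 * A * (T - j)" if "i < betti" for i
    proof -
      have "A * T \<le> A * (2 * (T - j))" using A j by (intro mult_left_mono) auto
      moreover have "real_of_int \<bar>h i\<bar> \<le> A * T" using h(2) that by blast
      ultimately show ?thesis by (simp add: algebra_simps)
    qed
    then obtain \<eta> where \<eta>: "exhausting x \<eta> x" "total_time \<eta> = T - j" "path_rotation (map fst \<eta>) = h"
      "path_action \<eta> \<le> (T - j) * C"
      using C(2)[OF xy(1,1), of "T - j" h] h(1) j T by auto
    have pz: "param_path y \<zeta> x" "param_path x \<eta> x"
      using \<zeta> \<eta> exhausting_param_path by blast+
    define \<Omega> where "\<Omega> = concat (replicate j (\<xi> @ \<zeta>)) @ \<eta>"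
    have sums: "sum_list (map \<phi> \<Omega>) = real j * (sum_list (map \<phi> \<xi>) + sum_list (map \<phi> \<zeta>)) + sum_list (map \<phi> \<eta>)"
      for \<phi> :: "_ \<Rightarrow> real"
      unfolding \<Omega>_def map_append sum_list_append sum_list_concat_replicate by simp
    have cyc: "awalk x (map fst (\<xi> @ \<zeta>)) x" "admissible (\<xi> @ \<zeta>)"
      using \<xi>(1) pz(1) unfolding param_path_def map_append
      by (auto simp: admissible_append intro: awalk_appendI simp del: awalk_append_iff)
    have \<Omega>: "param_path x \<Omega> x"
      unfolding param_path_def
    proof (intro conjI)
      show "\<Omega> \<noteq> []" using pz(2) by (auto simp: \<Omega>_def param_path_def)
      show "awalk x (map fst \<Omega>) x"
        using pz(2) awalk_concat_replicate[OF cyc] unfolding \<Omega>_def map_append param_path_def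
        by (blast intro: awalk_appendI)
      show "admissible \<Omega>"
        using pz(2) admissible_concat_replicate[OF cyc] unfolding \<Omega>_def param_path_def
        by (blast intro: admissible_append)
    qed
    \<comment> \<open>The time spent on closing up is saved in \<open>\<eta>\<close>:
      \<open>j * (T + 1) + (T - j) = (j + 1) * T\<close>.\<close>
    have time: "total_time \<Omega> = (real j + 1) * T"
      using \<xi>(2) \<zeta>(2) \<eta>(2) unfolding total_time_def sums by (simp add: algebra_simps)
    have rot: "real_of_int (path_rotation (map fst \<Omega>) i) = (real j + 1) * of_int (h i)" for i
      using real_path_rotation[of \<xi> i] real_path_rotation[of \<zeta> i] real_path_rotation[of \<eta> i]
      unfolding real_path_rotation[of \<Omega>] sums \<xi>(3) \<zeta>(3) \<eta>(3) by (simp add: algebra_simps)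
    have "measure_rotation (occupation \<Omega>) = (\<lambda>i. of_int (h i) / T)"
      unfolding fun_eq_iff rotation_occupation[OF \<Omega>] time rot
      by (intro allI mult_divide_mult_cancel_left) linarith
    then have "mather_beta (\<lambda>i. of_int (h i) / T) \<le> measure_action (occupation \<Omega>)"
      unfolding mather_beta_def using occupation_closed_measures[OF \<Omega>] by (intro INF_lower) simp
    also have "\<dots> = ereal (path_action \<Omega> / ((real j + 1) * T))"
      by (simp add: measure_action_occupation[OF \<Omega>] time)
    also have "\<dots> \<le> ereal ((path_action \<xi> + C') / T)"
    proof -
      have "path_action \<Omega> = real j * (path_action \<xi> + path_action \<zeta>) + path_action \<eta>"
        unfolding path_action_def by (rule sums)
      also have "\<dots> \<le> real j * (path_action \<xi> + C) + (T - j) * C"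
        using \<zeta>(4) \<eta>(4) by (intro add_mono mult_left_mono) auto
      also have "\<dots> \<le> real j * (path_action \<xi> + C) + T * C"
        using C(1) by (simp add: algebra_simps)
      also have "\<dots> \<le> (real j + 1) * (path_action \<xi> + C')"
      proof -
        have "- K * T \<le> path_action \<xi>" using path_action_ge[OF \<xi>(1) K(2)] \<xi>(2) by simp
        moreover have "K * T \<le> K * (2 * (real j + 1))" using j K by (intro mult_left_mono) auto
        moreover have "T * C \<le> (2 * (real j + 1)) * C" using j C by (intro mult_right_mono) auto
        ultimately show ?thesis using C(1) by (simp add: C'_def algebra_simps)
      qed
      finally have "path_action \<Omega> / (real j + 1) \<le> path_action \<xi> + C'"
        by (simp add: field_simps)
      then have "path_action \<Omega> / (real j + 1) / T \<le> (path_action \<xi> + C') / T"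
        using T by (intro divide_right_mono) auto
      then show ?thesis by simp
    qed
    finally show ?thesis .
  qed
  moreover have "0 \<le> C'" using K C by (simp add: C'_def)
  ultimately show ?thesis by blast
qed

section \<open>From closed measures to paths: bounding the minimal action by \<beta>\<close>

lemma measure_action_bounded_below:
  assumes mu: "\<mu> \<in> prob_measures"
    and K: "\<And>e v. e \<in> arcs G \<Longrightarrow> 0 \<le> v \<Longrightarrow> - K \<le> discrete_lag e v"
  shows "ereal (- K) \<le> measure_action \<mu>"
proof -
  have "(\<Sum>e\<in>arcs G. 0 * flux \<mu> e + - K * mass \<mu> e) = - K"
    using sum_mass[OF mu] by (simp add: sum_negf flip: sum_distrib_left)
  then show ?thesis using measure_action_ge[OF mu, of "\<lambda>_. 0" "\<lambda>_. - K"] K by simp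
qed

text \<open>
  If \<open>mass \<mu> e = 0\<close>, then the mean speed \<open>flux \<mu> e / mass \<mu> e\<close> is \<open>0\<close>.
\<close>

lemma mean_lag_le_measure_action:
  assumes mu: "\<mu> \<in> prob_measures" and eps: "0 < \<epsilon>" and m: "measure_action \<mu> \<le> ereal m"
  shows "(\<Sum>e\<in>arcs G. mass \<mu> e * discrete_lag e (flux \<mu> e / mass \<mu> e)) \<le> m + \<epsilon>"
proof -
  define q where "q = (\<lambda>e. flux \<mu> e / mass \<mu> e)"
  have q: "0 \<le> q e" for e using flux_nonneg[OF mu] mass_nonneg by (simp add: q_def)
  \<comment> \<open>The level \<open>a e\<close> gives a line below the Lagrangian that is within
    \<open>\<epsilon>\<close> of it at the mean speed. As the masses add up to 1, the total error is
    \<open>\<epsilon>\<close>.\<close>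
  have "\<forall>e\<in>arcs G. \<exists>a. min_level e \<le> a \<and> discrete_lag e (q e) - \<epsilon> \<le> sigma_int e a * q e - a"
    using discrete_lag_approx q eps by blast
  then obtain a where a: "\<And>e. e \<in> arcs G \<Longrightarrow>
      min_level e \<le> a e \<and> discrete_lag e (q e) - \<epsilon> \<le> sigma_int e (a e) * q e - a e"
    by metis
  have "ereal (\<Sum>e\<in>arcs G. sigma_int e (a e) * flux \<mu> e + - a e * mass \<mu> e) \<le> measure_action \<mu>"
    using discrete_lag_ge a by (intro measure_action_ge[OF mu]) auto
  then have "(\<Sum>e\<in>arcs G. sigma_int e (a e) * flux \<mu> e + - a e * mass \<mu> e) \<le> m"
    using m by (metis ereal_less_eq(3) order_trans)
  moreover have "(\<Sum>e\<in>arcs G. mass \<mu> e * (discrete_lag e (q e) - \<epsilon>)) \<le>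
      (\<Sum>e\<in>arcs G. sigma_int e (a e) * flux \<mu> e + - a e * mass \<mu> e)"
  proof (rule sum_mono)
    fix e assume e: "e \<in> arcs G"
    have "flux \<mu> e = mass \<mu> e * q e" using mass_eq_0_imp_flux_eq_0[OF mu e] by (simp add: q_def)
    moreover have "mass \<mu> e * (discrete_lag e (q e) - \<epsilon>) \<le> mass \<mu> e * (sigma_int e (a e) * q e - a e)"
      using a[OF e] mass_nonneg by (intro mult_left_mono) auto
    ultimately show "mass \<mu> e * (discrete_lag e (q e) - \<epsilon>) \<le> sigma_int e (a e) * flux \<mu> e + - a e * mass \<mu> e"
      by (simp add: algebra_simps)
  qed
  moreover have "(\<Sum>e\<in>arcs G. mass \<mu> e * (discrete_lag e (q e) - \<epsilon>)) =
      (\<Sum>e\<in>arcs G. mass \<mu> e * discrete_lag e (q e)) - \<epsilon>"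
    using sum_mass[OF mu] by (simp add: right_diff_distrib sum_subtractf flip: sum_distrib_right)
  ultimately show ?thesis by (simp add: q_def)
qed

text \<open>
  The multiplicities of the short loops in an approximating cycle are rescaled and rounded down, and
  one more copy of each loop is dropped to absorb the error of the approximation.
\<close>

lemma integral_flow_below_flux:
  "\<exists>D\<ge>0. \<forall>\<mu>\<in>closed_measures. \<forall>S\<ge>0. \<exists>n :: 'e list \<Rightarrow> nat. \<forall>e\<in>arcs G.
     real (\<Sum>c\<in>short_loops. n c * count_list c e) \<le> S * flux \<mu> e \<and>
     S * flux \<mu> e - real (\<Sum>c\<in>short_loops. n c * count_list c e) \<le> D"
proof -
  define N where "N = (\<Sum>c\<in>short_loops. length c)"
  \<comment> \<open>For each loop, rounding and dropping a copy lose at most 2, and the loop passes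
    an edge at most \<open>length c\<close> times. The final 1 is the approximation error.\<close>
  define D where "D = 2 * real N + 1"
  have "\<exists>n :: 'e list \<Rightarrow> nat. \<forall>e\<in>arcs G.
     real (\<Sum>c\<in>short_loops. n c * count_list c e) \<le> S * flux \<mu> e \<and>
     S * flux \<mu> e - real (\<Sum>c\<in>short_loops. n c * count_list c e) \<le> D"
    if mu: "\<mu> \<in> closed_measures" and S: "0 \<le> S" for \<mu> S
  proof -
    have mup: "\<mu> \<in> prob_measures" using mu by (simp add: closed_measures_def)
    \<comment> \<open>At this accuracy the fluxes scaled by \<open>S\<close> differ by at most 1;
      \<open>S + 1\<close> also covers \<open>S = 0\<close>.\<close>
    have "0 < 1 / (S + 1)" using S by simp
    then obtain z \<zeta> where z: "param_path z \<zeta> z" and W: "wasserstein \<mu> (occupation \<zeta>) < ennreal (1 / (S + 1))"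
      using mu unfolding closed_measures_def by blast
    have az: "admissible \<zeta>" "awalk z (map fst \<zeta>) z" using z by (auto simp: param_path_def)
    obtain k :: "'e list \<Rightarrow> nat"
      where k: "\<And>e. count_list (moving_arcs \<zeta>) e = (\<Sum>c\<in>short_loops. k c * count_list c e)"
      using loop_decomposition[OF awalk_moving_arcs[OF az]] by blast
    define l where "l = (\<lambda>c. S * k c / total_time \<zeta>)"
    \<comment> \<open>Subtraction is truncated: a loop rounded to multiplicity 0 has no copy to
      drop, so \<open>n_le'\<close> asks for \<open>0 < n c\<close>.\<close>
    define n where "n = (\<lambda>c. nat \<lfloor>l c\<rfloor> - 1)"
    have l: "0 \<le> l c" for c using S total_time_pos[OF z] by (simp add: l_def)
    have fl: "real (nat \<lfloor>l c\<rfloor>) = of_int \<lfloor>l c\<rfloor>" for c using l[of c] by simp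
    have n_le: "real (n c) \<le> l c" for c using fl[of c] l[of c] unfolding n_def by linarith
    have n_le': "real (n c) \<le> l c - 1" if "0 < n c" for c
      using fl[of c] that unfolding n_def by linarith
    have n_ge: "l c - real (n c) \<le> 2" for c using fl[of c] l[of c] unfolding n_def by linarith
    have near: "\<bar>S * flux \<mu> e - (\<Sum>c\<in>short_loops. l c * count_list c e)\<bar> \<le> 1" for e
    proof -
      have eq: "(\<Sum>c\<in>short_loops. l c * count_list c e) = S * flux (occupation \<zeta>) e"
        by (simp add: flux_occupation[OF z] k l_def sum_distrib_left sum_divide_distrib mult.assoc)
      have "\<bar>flux \<mu> e - flux (occupation \<zeta>) e\<bar> < 1 / (S + 1)"
        using flux_wasserstein[OF mup occupation_prob_measures[OF z] W] .
      then have "S * \<bar>flux \<mu> e - flux (occupation \<zeta>) e\<bar> \<le> S * (1 / (S + 1))"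
        using S by (intro mult_left_mono) auto
      also have "\<dots> \<le> 1" using S by (simp add: field_simps)
      finally show ?thesis using S by (simp add: eq abs_mult flip: right_diff_distrib)
    qed
    show ?thesis
    proof (intro exI[of _ n] ballI conjI)
      fix e assume "e \<in> arcs G"
      let ?n = "\<Sum>c\<in>short_loops. n c * count_list c e"
      show "real ?n \<le> S * flux \<mu> e"
      proof (cases "?n = 0")
        case True
        then show ?thesis using S flux_nonneg[OF mup] by simp
      next
        case False
        \<comment> \<open>A positive flow on \<open>e\<close> uses a loop \<open>c0\<close> through
          \<open>e\<close> with \<open>0 < n c0\<close>. Its dropped copy lowers the flow on
          \<open>e\<close> by at least 1, which pays for the error in \<open>near\<close>.\<close>
        then obtain c0 where c0: "c0 \<in> short_loops" "0 < n c0" "0 < count_list c0 e"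
          by (metis (no_types, lifting) gr0I mult_is_0 sum.neutral)
        have "real ?n \<le> (\<Sum>c\<in>short_loops. l c * count_list c e - (if c = c0 then 1 else 0))"
          unfolding of_nat_sum of_nat_mult
        proof (rule sum_mono)
          fix c
          show "real (n c) * real (count_list c e) \<le> l c * count_list c e - (if c = c0 then 1 else 0)"
          proof (cases "c = c0")
            case True
            have "real (n c) * count_list c e \<le> (l c - 1) * count_list c e"
              using n_le'[of c] c0 True by (intro mult_right_mono) auto
            then show ?thesis using True c0 by (simp add: algebra_simps)
          next
            case False
            then show ?thesis using n_le[of c] by (simp add: mult_right_mono)
          qed
        qed
        also have "\<dots> = (\<Sum>c\<in>short_loops. l c * count_list c e) - 1"
          using c0 finite_short_loops by (simp add: sum_subtractf)
        finally show ?thesis using near[of e] by linarith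
      qed
      have "(\<Sum>c\<in>short_loops. l c * count_list c e) - real ?n =
          (\<Sum>c\<in>short_loops. (l c - n c) * count_list c e)"
        by (simp add: left_diff_distrib sum_subtractf)
      also have "\<dots> \<le> (\<Sum>c\<in>short_loops. 2 * length c)"
        unfolding of_nat_sum
        using n_ge count_le_length by (intro sum_mono) (auto intro!: mult_mono)
      also have "\<dots> = 2 * real N" by (simp add: N_def sum_distrib_left)
      finally show "S * flux \<mu> e - real ?n \<le> D" using near[of e] by (simp add: D_def)
    qed
  qed
  moreover have "0 \<le> D" by (simp add: D_def)
  ultimately show ?thesis by blast
qed

lemma sum_short_loops:
  fixes \<psi> :: "'e \<Rightarrow> real"
  shows "(\<Sum>c\<in>short_loops. real (n c) * (\<Sum>e\<leftarrow>c. \<psi> e)) =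
    (\<Sum>e\<in>arcs G. real (\<Sum>c\<in>short_loops. n c * count_list c e) * \<psi> e)"
proof -
  have "(\<Sum>c\<in>short_loops. real (n c) * (\<Sum>e\<leftarrow>c. \<psi> e)) =
      (\<Sum>c\<in>short_loops. \<Sum>e\<in>arcs G. real (n c * count_list c e) * \<psi> e)"
  proof (rule sum.cong)
    fix c assume "c \<in> short_loops"
    then have "set c \<subseteq> arcs G" by (auto simp: short_loops_def awalk_def)
    from sum_list_count[OF this finite_arcs, of \<psi>]
    show "real (n c) * (\<Sum>e\<leftarrow>c. \<psi> e) = (\<Sum>e\<in>arcs G. real (n c * count_list c e) * \<psi> e)"
      by (simp add: sum_distrib_left mult.assoc)
  qed simp
  also have "\<dots> = (\<Sum>e\<in>arcs G. real (\<Sum>c\<in>short_loops. n c * count_list c e) * \<psi> e)"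
    unfolding of_nat_sum sum_distrib_right by (rule sum.swap)
  finally show ?thesis .
qed

text \<open>The carrier path meets every vertex, so the loops of the flow fit in one by one even if
  they are far apart. The index set \<open>?I\<close> lists the copies of each loop. An equilibrium
  circuit needs positive times, hence the restriction to \<open>0 < r e\<close>.\<close>

lemma exhausting_insert_flow:
  fixes n :: "'e list \<Rightarrow> nat" and q r :: "'e \<Rightarrow> real"
  defines "N \<equiv> \<lambda>e. real (\<Sum>c\<in>short_loops. n c * count_list c e)"
  assumes ex: "exhausting x \<xi> y" and q: "\<And>e. e \<in> arcs G \<Longrightarrow> 0 < N e \<Longrightarrow> 0 < q e"
  shows "\<exists>\<xi>'. exhausting x \<xi>' y \<and> (\<forall>\<phi>::_ \<Rightarrow> real. sum_list (map \<phi> \<xi>') = sum_list (map \<phi> \<xi>)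
    + (\<Sum>e\<in>arcs G. N e * \<phi> (e, q e, 1 / q e))
    + (\<Sum>e | e \<in> arcs G \<and> 0 < r e. \<phi> (e, 0, r e / 2) + \<phi> (arev e, 0, r e / 2)))"
proof -
  let ?I = "SIGMA c:short_loops. {..<n c}"
  let ?J = "{e \<in> arcs G. 0 < r e}"
  let ?\<zeta> = "\<lambda>i. map (\<lambda>e. (e, q e, 1 / q e)) (fst i)"
  have q': "0 < q e" if "c \<in> short_loops" "0 < n c" "e \<in> set c" for c e
  proof (rule q)
    show "e \<in> arcs G" using that by (auto simp: short_loops_def awalk_def)
    have "0 < count_list c e" using that(3) count_notin by (metis count_list_0_iff gr0I)
    then have "0 < n c * count_list c e" using that by simp
    also have "\<dots> \<le> (\<Sum>c\<in>short_loops. n c * count_list c e)"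
      using that finite_short_loops by (intro member_le_sum) auto
    finally show "0 < N e" by (simp only: N_def of_nat_0_less_iff)
  qed
  have "\<exists>u. awalk u (map fst (?\<zeta> i)) u" "admissible (?\<zeta> i)" if i: "i \<in> ?I" for i
  proof -
    have "map fst (?\<zeta> i) = fst i" by (simp add: o_def)
    then show "\<exists>u. awalk u (map fst (?\<zeta> i)) u" using i by (auto simp: short_loops_def)
    show "admissible (?\<zeta> i)" using q' i by (intro admissible_moving_list) auto
  qed
  moreover have "finite ?I" using finite_short_loops by simp
  ultimately obtain \<xi>1 where 1: "exhausting x \<xi>1 y" "\<And>\<phi>::_ \<Rightarrow> real.
      sum_list (map \<phi> \<xi>1) = sum_list (map \<phi> \<xi>) + (\<Sum>i\<in>?I. sum_list (map \<phi> (?\<zeta> i)))"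
    using exhausting_insert_family[OF ex, of ?I ?\<zeta>] by blast
  have 2: "(\<Sum>i\<in>?I. sum_list (map \<phi> (?\<zeta> i))) = (\<Sum>e\<in>arcs G. N e * \<phi> (e, q e, 1 / q e))"
    for \<phi> :: "_ \<Rightarrow> real"
  proof -
    have "(\<Sum>i\<in>?I. sum_list (map \<phi> (?\<zeta> i))) =
        (\<Sum>c\<in>short_loops. \<Sum>j\<in>{..<n c}. sum_list (map \<phi> (?\<zeta> (c, j))))"
      using finite_short_loops by (subst sum.Sigma) (auto simp: split_beta)
    also have "\<dots> = (\<Sum>c\<in>short_loops. real (n c) * (\<Sum>e\<leftarrow>c. \<phi> (e, q e, 1 / q e)))"
      by (simp add: o_def)
    finally show ?thesis unfolding N_def sum_short_loops .
  qed
  let ?\<eta> = "\<lambda>e. [(e, 0, r e / 2), (arev e, 0, r e / 2)]"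
  have "\<exists>u. awalk u (map fst (?\<eta> e)) u" "admissible (?\<eta> e)" if e: "e \<in> ?J" for e
  proof -
    show "\<exists>u. awalk u (map fst (?\<eta> e)) u" using e by (auto simp: awalk_simps)
    show "admissible (?\<eta> e)" using e by (auto intro!: admissible.intros)
  qed
  moreover have "finite ?J" by simp
  ultimately obtain \<xi>2 where 3: "exhausting x \<xi>2 y" "\<And>\<phi>::_ \<Rightarrow> real.
      sum_list (map \<phi> \<xi>2) = sum_list (map \<phi> \<xi>1) + (\<Sum>e\<in>?J. sum_list (map \<phi> (?\<eta> e)))"
    using exhausting_insert_family[OF 1(1), of ?J ?\<eta>] by blast
  show ?thesis using 3(1) 3(2)[unfolded 1(2) 2] by (intro exI[of _ \<xi>2]) simp
qed

lemma path_action_le: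
  assumes A: "0 \<le> A"
  shows "\<exists>C\<ge>0. \<forall>x\<in>verts G. \<forall>y\<in>verts G. \<forall>T\<ge>2. \<forall>h. \<forall>\<mu>\<in>closed_measures. \<forall>m. (\<forall>i\<ge>betti. h i = 0) \<longrightarrow>
    (\<forall>i<betti. real_of_int \<bar>h i\<bar> \<le> A * T) \<longrightarrow> measure_rotation \<mu> = (\<lambda>i. of_int (h i) / T) \<longrightarrow>
    measure_action \<mu> \<le> ereal m \<longrightarrow>
    (\<exists>\<xi>. param_path x \<xi> y \<and> total_time \<xi> = T \<and> path_rotation (map fst \<xi>) = h \<and>
      path_action \<xi> \<le> T * m + C)"
proof -
  obtain K where K: "K \<ge> 0" "\<And>e v. e \<in> arcs G \<Longrightarrow> 0 \<le> v \<Longrightarrow> - K \<le> discrete_lag e v"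
    using discrete_lag_bounded_below by blast
  obtain D where D: "D \<ge> 0" "\<And>\<mu> S. \<mu> \<in> closed_measures \<Longrightarrow> 0 \<le> S \<Longrightarrow> \<exists>n :: 'e list \<Rightarrow> nat. \<forall>e\<in>arcs G.
     real (\<Sum>c\<in>short_loops. n c * count_list c e) \<le> S * flux \<mu> e \<and>
     S * flux \<mu> e - real (\<Sum>c\<in>short_loops. n c * count_list c e) \<le> D"
    using integral_flow_below_flux by blast
  \<comment> \<open>\<open>B\<close> bounds the rotation left for the last unit of time: the flow
    misses at most \<open>D\<close> on each edge, and the flux during \<open>T - 1\<close> falls
    short of \<open>h\<close> by \<open>h / T\<close>.\<close>
  define B where "B = card (arcs G) * D + A"
  have "0 \<le> B" using A D by (simp add: B_def)
  then obtain C where C: "C \<ge> 0" "\<And>x y S h. x \<in> verts G \<Longrightarrow> y \<in> verts G \<Longrightarrow> 1 \<le> S \<Longrightarrow> (\<forall>i\<ge>betti. h i = 0) \<Longrightarrow>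
    (\<forall>i<betti. real_of_int \<bar>h i\<bar> \<le> B * S) \<Longrightarrow>
    (\<exists>\<xi>. exhausting x \<xi> y \<and> total_time \<xi> = S \<and> path_rotation (map fst \<xi>) = h \<and> path_action \<xi> \<le> S * C)"
    using uniform_path_with_rotation[of B] by auto
  \<comment> \<open>\<open>C\<close> is for the correcting path and the sum for the loss from
    resting; 1 is the slack \<open>1 / T\<close> of Jensen's inequality times \<open>T\<close>, and
    \<open>K\<close> covers the Lagrangian of the missing unit of time.\<close>
  define C' where "C' = C + (\<Sum>e\<in>arcs G. \<bar>min_momentum e\<bar> * D) + 1 + K"
  have "\<exists>\<xi>. param_path x \<xi> y \<and> total_time \<xi> = T \<and> path_rotation (map fst \<xi>) = h \<and>
      path_action \<xi> \<le> T * m + C'"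
    if xy: "x \<in> verts G" "y \<in> verts G" and T: "2 \<le> T" and mu: "\<mu> \<in> closed_measures"
      and h: "\<forall>i\<ge>betti. h i = 0" "\<forall>i<betti. real_of_int \<bar>h i\<bar> \<le> A * T"
      and rot: "measure_rotation \<mu> = (\<lambda>i. of_int (h i) / T)" and act: "measure_action \<mu> \<le> ereal m"
    for x y T h \<mu> m
  proof -
    have mup: "\<mu> \<in> prob_measures" using mu by (simp add: closed_measures_def)
    define q where "q = (\<lambda>e. flux \<mu> e / mass \<mu> e)"
    have q: "0 \<le> q e" for e using flux_nonneg[OF mup] mass_nonneg by (simp add: q_def)
    have flux: "flux \<mu> e = mass \<mu> e * q e" if "e \<in> arcs G" for e
      using mass_eq_0_imp_flux_eq_0[OF mup that] by (simp add: q_def)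
    obtain n :: "'e list \<Rightarrow> nat" where n: "\<And>e. e \<in> arcs G \<Longrightarrow>
        real (\<Sum>c\<in>short_loops. n c * count_list c e) \<le> (T - 1) * flux \<mu> e \<and>
        (T - 1) * flux \<mu> e - real (\<Sum>c\<in>short_loops. n c * count_list c e) \<le> D"
      using D(2)[OF mu, of "T - 1"] T by auto
    define N where "N = (\<lambda>e. \<Sum>c\<in>short_loops. n c * count_list c e)"
    have N: "real (N e) \<le> (T - 1) * flux \<mu> e" "(T - 1) * flux \<mu> e - real (N e) \<le> D" if "e \<in> arcs G" for e
      using n[OF that] by (auto simp only: N_def)
    have q_pos: "0 < q e" if "e \<in> arcs G" "0 < N e" for e
      using N(1)[OF that(1)] flux[OF that(1)] that(2) q[of e] by (cases "q e = 0") auto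
    \<comment> \<open>The time budget of the edge minus the time spent moving. If
      \<open>q e = 0\<close>, then \<open>N e = 0\<close> and the quotient is 0, so the whole budget
      is rest.\<close>
    define r where "r = (\<lambda>e. (T - 1) * mass \<mu> e - N e / q e)"
    have rq: "r e * q e = (T - 1) * flux \<mu> e - N e" if e: "e \<in> arcs G" for e
      using flux[OF e] q_pos[OF e] by (cases "N e = 0"; cases "q e = 0") (auto simp: r_def field_simps)
    have r: "0 \<le> r e" if e: "e \<in> arcs G" for e
    proof (cases "q e = 0")
      case True
      then show ?thesis using T mass_nonneg by (simp add: r_def)
    next
      case False
      then show ?thesis using rq[OF e] N(1)[OF e] q[of e] by (metis diff_ge_0_iff_ge less_eq_real_def zero_le_mult_iff not_le)
    qed

    define g where "g = (\<lambda>i. h i - (\<Sum>e\<in>arcs G. theta e i * int (N e)))"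
    have g_real: "real_of_int (g i) = (\<Sum>e\<in>arcs G. of_int (theta e i) * ((T - 1) * flux \<mu> e - N e)) + of_int (h i) / T"
      for i
    proof -
      have "of_int (h i) / T = (\<Sum>e\<in>arcs G. of_int (theta e i) * flux \<mu> e)"
        using fun_cong[OF rot, of i] measure_rotation_flux[OF mup, of i] by simp
      moreover from this have "of_int (h i) = T * (\<Sum>e\<in>arcs G. of_int (theta e i) * flux \<mu> e)"
        using T by (simp add: field_simps)
      ultimately show ?thesis
        by (simp add: g_def sum_distrib_left sum.distrib sum_subtractf algebra_simps)
    qed
    have "real_of_int \<bar>g i\<bar> \<le> B * 1" if "i < betti" for i
    proof -
      have "\<bar>\<Sum>e\<in>arcs G. of_int (theta e i) * ((T - 1) * flux \<mu> e - N e)\<bar> \<le>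
          (\<Sum>e\<in>arcs G. \<bar>of_int (theta e i) * ((T - 1) * flux \<mu> e - N e)\<bar>)" by (rule sum_abs)
      also have "\<dots> \<le> (\<Sum>e\<in>arcs G. 1 * D)"
        unfolding abs_mult using N theta_bound[of _ i]
        by (intro sum_mono mult_mono) (auto simp: abs_le_iff simp flip: of_int_abs)
      finally have "\<bar>\<Sum>e\<in>arcs G. of_int (theta e i) * ((T - 1) * flux \<mu> e - N e)\<bar> \<le> card (arcs G) * D" by simp
      moreover have "\<bar>of_int (h i) / T\<bar> \<le> A" using h(2) that T by (auto simp: field_simps)
      ultimately have "\<bar>real_of_int (g i)\<bar> \<le> B" unfolding g_real B_def by linarith
      then show ?thesis by simp
    qed
    moreover have "\<forall>i\<ge>betti. g i = 0" using h(1) by (simp add: g_def theta_ge)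
    ultimately obtain \<xi>0 where \<xi>0: "exhausting x \<xi>0 y" "total_time \<xi>0 = 1" "path_rotation (map fst \<xi>0) = g"
      "path_action \<xi>0 \<le> C"
      using C(2)[OF xy, of 1 g] by auto

    obtain \<xi> where \<xi>: "exhausting x \<xi> y" "\<And>\<phi>::_ \<Rightarrow> real. sum_list (map \<phi> \<xi>) = sum_list (map \<phi> \<xi>0)
      + (\<Sum>e\<in>arcs G. N e * \<phi> (e, q e, 1 / q e))
      + (\<Sum>e | e \<in> arcs G \<and> 0 < r e. \<phi> (e, 0, r e / 2) + \<phi> (arev e, 0, r e / 2))"
      using exhausting_insert_flow[OF \<xi>0(1), of n q r] q_pos unfolding N_def of_nat_0_less_iff by blast
    have drop: "(\<Sum>e | e \<in> arcs G \<and> 0 < r e. r e * u e) = (\<Sum>e\<in>arcs G. r e * u e)" for u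
      using r by (intro sum.mono_neutral_left) (auto simp: not_less intro: antisym)
    have "total_time \<xi> = 1 + (\<Sum>e\<in>arcs G. N e * (1 / q e)) + (\<Sum>e\<in>arcs G. r e)"
      using \<xi>0(2) drop[of "\<lambda>_. 1"] unfolding total_time_def \<xi>(2) by simp
    also have "\<dots> = 1 + (\<Sum>e\<in>arcs G. (T - 1) * mass \<mu> e)"
      by (simp add: r_def sum_subtractf)
    also have "\<dots> = T" using sum_mass[OF mup] by (simp flip: sum_distrib_left)
    finally have time: "total_time \<xi> = T" .
    have "real_of_int (path_rotation (map fst \<xi>) i) = of_int (h i)" for i
    proof -
      have "real_of_int (path_rotation (map fst \<xi>) i) = of_int (g i) + (\<Sum>e\<in>arcs G. N e * of_int (theta e i))"
        unfolding real_path_rotation[of \<xi>] \<xi>(2) using real_path_rotation[of \<xi>0 i] \<xi>0(3)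
        by (simp add: theta_arev)
      then show ?thesis by (simp add: g_def mult.commute)
    qed
    then have rotation: "path_rotation (map fst \<xi>) = h" by (simp add: fun_eq_iff)
    have "path_action \<xi> = path_action \<xi>0 + (\<Sum>e\<in>arcs G. N e * (1 / q e * discrete_lag e (q e)))
        + (\<Sum>e\<in>arcs G. r e * discrete_lag e 0)"
    proof -
      have "(\<Sum>e | e \<in> arcs G \<and> 0 < r e. r e / 2 * discrete_lag e 0 + r e / 2 * discrete_lag (arev e) 0) =
          (\<Sum>e | e \<in> arcs G \<and> 0 < r e. r e * discrete_lag e 0)"
        by (intro sum.cong) (auto simp: discrete_lag_0_arev)
      then show ?thesis using drop[of "\<lambda>e. discrete_lag e 0"] unfolding path_action_def \<xi>(2) by simp
    qed
    also have "\<dots> \<le> C + (\<Sum>e\<in>arcs G. N e * (1 / q e * discrete_lag e (q e)) + r e * discrete_lag e 0)"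
      using \<xi>0(4) by (simp add: sum.distrib)
    also have "\<dots> \<le> C + (\<Sum>e\<in>arcs G. (T - 1) * (mass \<mu> e * discrete_lag e (q e)) + \<bar>min_momentum e\<bar> * D)"
    proof (intro add_left_mono sum_mono)
      fix e assume e: "e \<in> arcs G"
      \<comment> \<open>Rest replaces motion at speed \<open>q e\<close> for the time
        \<open>r e\<close>; the product \<open>r e * q e\<close> is the flux lost by rounding, at
        most \<open>D\<close>.\<close>
      have "r e * (discrete_lag e 0 - discrete_lag e (q e)) \<le> r e * (- min_momentum e * q e)"
        using discrete_lag_ge_tangent_0[OF e q] r[OF e] by (intro mult_left_mono) (auto simp: algebra_simps)
      also have "\<dots> = - min_momentum e * (r e * q e)" by simp
      also have "\<dots> \<le> \<bar>min_momentum e\<bar> * (r e * q e)"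
        using r[OF e] q[of e] by (intro mult_right_mono) auto
      also have "\<dots> \<le> \<bar>min_momentum e\<bar> * D"
        using N(2)[OF e] by (intro mult_left_mono) (auto simp: rq[OF e])
      finally show "N e * (1 / q e * discrete_lag e (q e)) + r e * discrete_lag e 0 \<le>
          (T - 1) * (mass \<mu> e * discrete_lag e (q e)) + \<bar>min_momentum e\<bar> * D"
        by (simp add: r_def algebra_simps)
    qed
    also have "\<dots> = C + (\<Sum>e\<in>arcs G. \<bar>min_momentum e\<bar> * D) + (T - 1) * (\<Sum>e\<in>arcs G. mass \<mu> e * discrete_lag e (q e))"
      by (simp add: sum.distrib sum_distrib_left)
    also have "(T - 1) * (\<Sum>e\<in>arcs G. mass \<mu> e * discrete_lag e (q e)) \<le> T * m + 1 + K"
    proof -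
      let ?L = "\<Sum>e\<in>arcs G. mass \<mu> e * discrete_lag e (q e)"
      have "?L \<le> m + 1 / T" unfolding q_def using T act by (intro mean_lag_le_measure_action[OF mup]) auto
      then have "T * ?L \<le> T * (m + 1 / T)" using T by (intro mult_left_mono) auto
      moreover have "T * (m + 1 / T) = T * m + 1" using T by (simp add: field_simps)
      moreover have "(\<Sum>e\<in>arcs G. mass \<mu> e * (- K)) \<le> ?L"
        using K(2) q mass_nonneg by (intro sum_mono mult_left_mono) auto
      then have "- K \<le> ?L" using sum_mass[OF mup] by (simp add: sum_negf flip: sum_distrib_right)
      ultimately show ?thesis by (simp add: algebra_simps)
    qed
    finally have "path_action \<xi> \<le> T * m + C'" by (simp add: C'_def)
    then show ?thesis using exhausting_param_path[OF \<xi>(1)] time rotation by blast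
  qed
  moreover have "0 \<le> C'" using C(1) D(1) K(1) by (simp add: C'_def sum_nonneg)
  ultimately show ?thesis by blast
qed

text \<open>Finiteness comes first: \<beta> is bounded below by the bound of the Lagrangian and
  above through one explicit path. Then the two comparisons become inequalities between
  reals.\<close>

lemma min_action_mather_beta:
  assumes A: "0 \<le> A"
  shows "\<exists>C\<ge>0. \<forall>x\<in>verts G. \<forall>y\<in>verts G. \<forall>T\<ge>2. \<forall>h. (\<forall>i\<ge>betti. h i = 0) \<longrightarrow>
    (\<forall>i<betti. real_of_int \<bar>h i\<bar> \<le> A * T) \<longrightarrow>
    (\<exists>a b. min_action x y T h = ereal a \<and> mather_beta (\<lambda>i. of_int (h i) / T) = ereal b \<and> \<bar>a - T * b\<bar> \<le> C)"
proof -
  obtain K where K: "K \<ge> 0" "\<And>e v. e \<in> arcs G \<Longrightarrow> 0 \<le> v \<Longrightarrow> - K \<le> discrete_lag e v"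
    using discrete_lag_bounded_below by blast
  obtain C0 where C0: "\<And>x y S h. x \<in> verts G \<Longrightarrow> y \<in> verts G \<Longrightarrow> 1 \<le> S \<Longrightarrow> (\<forall>i\<ge>betti. h i = 0) \<Longrightarrow>
    (\<forall>i<betti. real_of_int \<bar>h i\<bar> \<le> A * S) \<Longrightarrow>
    (\<exists>\<xi>. exhausting x \<xi> y \<and> total_time \<xi> = S \<and> path_rotation (map fst \<xi>) = h \<and> path_action \<xi> \<le> S * C0)"
    using uniform_path_with_rotation[OF A] by blast
  obtain C1 where C1: "C1 \<ge> 0" "\<And>x y T h \<xi>. x \<in> verts G \<Longrightarrow> y \<in> verts G \<Longrightarrow> 2 \<le> T \<Longrightarrow> (\<forall>i\<ge>betti. h i = 0) \<Longrightarrow>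
    (\<forall>i<betti. real_of_int \<bar>h i\<bar> \<le> A * T) \<Longrightarrow> param_path x \<xi> y \<Longrightarrow> total_time \<xi> = T \<Longrightarrow>
    path_rotation (map fst \<xi>) = h \<Longrightarrow>
    mather_beta (\<lambda>i. of_int (h i) / T) \<le> ereal ((path_action \<xi> + C1) / T)"
    using mather_beta_le[OF A] by blast
  obtain C2 where C2: "C2 \<ge> 0" "\<And>x y T h \<mu> m. x \<in> verts G \<Longrightarrow> y \<in> verts G \<Longrightarrow> 2 \<le> T \<Longrightarrow> \<mu> \<in> closed_measures \<Longrightarrow>
    (\<forall>i\<ge>betti. h i = 0) \<Longrightarrow> (\<forall>i<betti. real_of_int \<bar>h i\<bar> \<le> A * T) \<Longrightarrow>
    measure_rotation \<mu> = (\<lambda>i. of_int (h i) / T) \<Longrightarrow> measure_action \<mu> \<le> ereal m \<Longrightarrow>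
    (\<exists>\<xi>. param_path x \<xi> y \<and> total_time \<xi> = T \<and> path_rotation (map fst \<xi>) = h \<and>
      path_action \<xi> \<le> T * m + C2)"
    using path_action_le[OF A] by blast
  have "\<exists>a b. min_action x y T h = ereal a \<and> mather_beta (\<lambda>i. of_int (h i) / T) = ereal b \<and>
      \<bar>a - T * b\<bar> \<le> C1 + C2 + 1"
    if xy: "x \<in> verts G" "y \<in> verts G" and T: "2 \<le> T" and h: "\<forall>i\<ge>betti. h i = 0"
      "\<forall>i<betti. real_of_int \<bar>h i\<bar> \<le> A * T" for x y T h
  proof -
    let ?\<beta> = "mather_beta (\<lambda>i. of_int (h i) / T)"
    let ?P = "{\<xi>. param_path x \<xi> y \<and> total_time \<xi> = T \<and> path_rotation (map fst \<xi>) = h}"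
    obtain \<xi>0 where \<xi>0: "\<xi>0 \<in> ?P" using C0[OF xy _ h] T exhausting_param_path by fastforce
    have "ereal (- K) \<le> ?\<beta>"
      unfolding mather_beta_def
      by (intro INF_greatest measure_action_bounded_below K(2)) (auto simp: closed_measures_def)
    moreover have "?\<beta> \<le> ereal ((path_action \<xi>0 + C1) / T)" using C1(2)[OF xy T h] \<xi>0 by blast
    ultimately obtain b where b: "?\<beta> = ereal b" by (cases ?\<beta>) auto
    have "ereal (T * b - C1) \<le> min_action x y T h"
      unfolding min_action_def
    proof (rule INF_greatest)
      fix \<xi> assume "\<xi> \<in> ?P"
      then have "ereal b \<le> ereal ((path_action \<xi> + C1) / T)" using C1(2)[OF xy T h] b by fastforce
      then show "ereal (T * b - C1) \<le> ereal (path_action \<xi>)" using T by (simp add: field_simps)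
    qed
    moreover have "min_action x y T h \<le> ereal (T * b + 1 + C2)"
    proof -
      \<comment> \<open>The infimum need not be attained; a slack of \<open>1 / T\<close> costs 1
        after scaling by \<open>T\<close>.\<close>
      have "?\<beta> < ereal (b + 1 / T)" using b T by simp
      then obtain \<mu> where mu: "\<mu> \<in> closed_measures" "measure_rotation \<mu> = (\<lambda>i. of_int (h i) / T)"
        "measure_action \<mu> < ereal (b + 1 / T)"
        unfolding mather_beta_def by (auto simp: INF_less_iff)
      obtain \<xi> where \<xi>: "\<xi> \<in> ?P" "path_action \<xi> \<le> T * (b + 1 / T) + C2"
        using C2(2)[OF xy T mu(1) h mu(2) less_imp_le[OF mu(3)]] by blast
      have "min_action x y T h \<le> ereal (path_action \<xi>)"
        unfolding min_action_def using \<xi>(1) by (rule INF_lower)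
      also have "path_action \<xi> \<le> T * b + 1 + C2" using \<xi>(2) T by (simp add: distrib_left)
      finally show ?thesis by simp
    qed
    ultimately obtain a where "min_action x y T h = ereal a" "T * b - C1 \<le> a" "a \<le> T * b + 1 + C2"
      by (cases "min_action x y T h") auto
    then show ?thesis using b C1(1) C2(1) by (intro exI[of _ a] exI[of _ b]) auto
  qed
  then show ?thesis using C1(1) C2(1) by (intro exI[of _ "C1 + C2 + 1"]) auto
qed

end

theorem theorem6p26:
  fixes G :: "('v, 'e) pre_digraph" and arev :: "'e \<Rightarrow> 'e"
    and Eplus ET :: "'e set" and f :: "nat \<Rightarrow> 'e"
    and H :: "'e \<Rightarrow> real \<Rightarrow> real \<Rightarrow> real"
    and A \<delta> :: real
  assumes "hamiltonian_graph G arev Eplus ET f H"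
    and "A > 0" and "\<delta> > 0"
  shows "\<exists>T0>0. \<forall>T\<ge>T0. \<forall>x\<in>verts G. \<forall>y\<in>verts G.
    \<forall>h::nat \<Rightarrow> int. (\<forall>i\<ge>rotation_graph.betti G. h i = 0) \<longrightarrow>
      L2_set (\<lambda>i. of_int (h i) / T) {..<rotation_graph.betti G} < A \<longrightarrow>
      \<bar>ereal (1 / T) * hamiltonian_graph.min_action G arev f H x y T h
         - hamiltonian_graph.mather_beta G arev f H (\<lambda>i. of_int (h i) / T)\<bar> < ereal \<delta>"
proof -
  interpret hamiltonian_graph G arev Eplus ET f H by (rule assms)
  obtain C where C: "C \<ge> 0" "\<And>x y T h. x \<in> verts G \<Longrightarrow> y \<in> verts G \<Longrightarrow> 2 \<le> T \<Longrightarrow> (\<forall>i\<ge>betti. h i = 0) \<Longrightarrow>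
    (\<forall>i<betti. real_of_int \<bar>h i\<bar> \<le> A * T) \<Longrightarrow>
    (\<exists>a b. min_action x y T h = ereal a \<and> mather_beta (\<lambda>i. of_int (h i) / T) = ereal b \<and> \<bar>a - T * b\<bar> \<le> C)"
    using min_action_mather_beta[OF less_imp_le[OF assms(2)]] by blast
  \<comment> \<open>Dividing the bounded error by \<open>T\<close> leaves \<open>C / T\<close>; the
    1 added to \<open>C / \<delta>\<close> makes this strictly smaller than
    \<open>\<delta>\<close>.\<close>
  have "\<bar>ereal (1 / T) * min_action x y T h - mather_beta (\<lambda>i. of_int (h i) / T)\<bar> < ereal \<delta>"
    if T: "T \<ge> max 2 (C / \<delta> + 1)" and xy: "x \<in> verts G" "y \<in> verts G" and h: "\<forall>i\<ge>betti. h i = 0"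
      and L2: "L2_set (\<lambda>i. of_int (h i) / T) {..<betti} < A" for T x y and h :: "nat \<Rightarrow> int"
  proof -
    have "real_of_int \<bar>h i\<bar> \<le> A * T" if "i < betti" for i
    proof -
      have "\<bar>of_int (h i) / T\<bar> \<le> L2_set (\<lambda>i. \<bar>of_int (h i) / T\<bar>) {..<betti}"
        using that by (intro member_le_L2_set) auto
      also have "\<dots> = L2_set (\<lambda>i. of_int (h i) / T) {..<betti}"
        unfolding L2_set_def power2_abs ..
      finally have "\<bar>of_int (h i) / T\<bar> \<le> A" using L2 by linarith
      then show ?thesis using T by (simp add: field_simps)
    qed
    moreover have "2 \<le> T" using T by simp
    ultimately obtain a b where ab: "min_action x y T h = ereal a"
      "mather_beta (\<lambda>i. of_int (h i) / T) = ereal b" "\<bar>a - T * b\<bar> \<le> C"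
      using C(2)[OF xy _ h] by meson
    have "1 / T * a - b = (a - T * b) / T" using T by (simp add: field_simps)
    then have "\<bar>1 / T * a - b\<bar> \<le> C / T" using ab(3) T by (simp add: divide_right_mono)
    also have "C < T * \<delta>"
    proof -
      have "C / \<delta> < T" using T by simp
      then show ?thesis using assms(3) by (simp add: field_simps)
    qed
    then have "C / T < \<delta>" using T by (simp add: field_simps)
    finally show ?thesis by (simp add: ab)
  qed
  then show ?thesis by (intro exI[of _ "max 2 (C / \<delta> + 1)"]) auto
qed

end
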